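(* Let $n$ be a non-negative integer, and let $N$ and $M$ be the unique positive integers for which $$4n+1=N^2M$$ where $M$ is square-free. Then the following are true: (1) If $M=1$, then $ped_{-2}(n)$ is odd. (2) If $M=p$ is a prime and $\mathrm{ord}_p(4n+1)\equiv 1\pmod 4$, then $ped_{-2}(n)\equiv 2\pmod 4$. (3) If $M=p$ is a prime and $\mathrm{ord}_p(4n+1)\equiv 3\pmod 8$, then $ped_{-2}(n)\equiv 4\pmod 8$. (4) If $M=p_1p_2$, where $p_1$ and $p_2$ are distinct primes with $p_i\equiv 1\pmod 4$ and $\mathrm{ord}_{p_i}(4n+1)\equiv 1\pmod 4$ for $i=1,2$, then $ped_{-2}(n)\equiv 4\pmod 8$. (5) In all other cases, $ped_{-2}(n)\equiv 0\pmod 8$.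
   Context: For an integer $n\ge 0$, $ped_{-2}(n)$ denotes the number of bipartitions of $n$ with even parts distinct, i.e. the number of ordered pairs of partitions $(\lambda,\mu)$ with total size $|\lambda|+|\mu|=n$ such that in each of $\lambda$ and $\mu$ the even parts are distinct (odd parts are unrestricted). Its generating function is $$\sum_{n=0}^{\infty}ped_{-2}(n)q^n=\prod_{m=1}^{\infty}\frac{(1-q^{4m})^2}{(1-q^m)^2}.$$ For a prime $p$ and a positive integer $k$, $\mathrm{ord}_p(k)$ denotes the exponent of the highest power of $p$ dividing $k$. *)

theory Defs
  imports
    "HOL-Library.Multiset"
    "HOL-Number_Theory.Number_Theory"
    "HOL-Computational_Algebra.Squarefree"
begin

text \<open>
  A partition is the multiset of its (positive) parts; its size is the sum of the parts
  \<open>\<Sum>\<^sub># A\<close> (not the multiset cardinality \<^const>\<open>size\<close>).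
\<close>

definition partition_of :: "nat multiset \<Rightarrow> nat \<Rightarrow> bool" where
  "partition_of A n \<longleftrightarrow> 0 \<notin># A \<and> \<Sum>\<^sub># A = n"

definition even_parts_distinct :: "nat multiset \<Rightarrow> bool" where
  "even_parts_distinct A \<longleftrightarrow> (\<forall>k. even k \<longrightarrow> count A k \<le> 1)"

definition ped_bipartitions :: "nat \<Rightarrow> (nat multiset \<times> nat multiset) set" where
  "ped_bipartitions n =
    {(A, B). (\<exists>a b. a + b = n \<and> partition_of A a \<and> partition_of B b) \<and>
             even_parts_distinct A \<and> even_parts_distinct B}"

definition ped2 :: "nat \<Rightarrow> nat" where
  "ped2 n = card (ped_bipartitions n)"

text \<open>
  The set counted by \<^const>\<open>ped2\<close> is finite, so the cardinality is the genuine one.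
\<close>

lemma size_le_sum_mset: "0 \<notin># A \<Longrightarrow> size A \<le> \<Sum>\<^sub># A" for A :: "nat multiset"
  by (induction A) auto

lemma finite_partitions_le: "finite {A. 0 \<notin># A \<and> \<Sum>\<^sub># A \<le> n}" for n :: nat
proof (rule finite_subset)
  show "{A. 0 \<notin># A \<and> \<Sum>\<^sub># A \<le> n} \<subseteq> mset ` {xs. set xs \<subseteq> {..n} \<and> length xs \<le> n}"
  proof
    fix A :: "nat multiset" assume "A \<in> {A. 0 \<notin># A \<and> \<Sum>\<^sub># A \<le> n}"
    hence l: "0 \<notin># A" "\<Sum>\<^sub># A \<le> n" by auto
    obtain xs where xs: "mset xs = A" using ex_mset by blast
    have "x \<le> n" if "x \<in># A" for x
    proof -
      from that obtain C where "A = add_mset x C" by (blast dest: multi_member_split)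
      with l(2) show ?thesis by simp
    qed
    moreover have "length xs \<le> n"
      using size_le_sum_mset[OF l(1)] l(2) xs by (metis le_trans size_mset)
    ultimately show "A \<in> mset ` {xs. set xs \<subseteq> {..n} \<and> length xs \<le> n}"
      using xs by (intro image_eqI[of _ _ xs]) auto
  qed
  show "finite (mset ` {xs. set xs \<subseteq> {..n} \<and> length xs \<le> n})"
    by (intro finite_imageI finite_lists_length_le) simp
qed

lemma finite_ped_bipartitions: "finite (ped_bipartitions n)"
proof (rule finite_subset)
  let ?P = "{A. 0 \<notin># A \<and> \<Sum>\<^sub># A \<le> n}"
  show "ped_bipartitions n \<subseteq> ?P \<times> ?P"
    by (auto simp: ped_bipartitions_def partition_of_def)
  show "finite (?P \<times> ?P)"
    by (intro finite_cartesian_product finite_partitions_le)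
qed

text \<open>
  Justifies speaking of the unique \<open>N\<close> and \<open>M\<close> by universally quantified variables.
\<close>

lemma ex1_square_times_squarefree:
  fixes m :: nat
  assumes "m > 0"
  shows "\<exists>!(N, M). N > 0 \<and> M > 0 \<and> m = N\<^sup>2 * M \<and> squarefree M"
proof -
  have mult: "multiplicity p N = multiplicity p m div 2"
    if "N > 0" "M > 0" "m = N\<^sup>2 * M" "squarefree M" "prime p" for p N M :: nat
  proof -
    have "multiplicity p m = 2 * multiplicity p N + multiplicity p M"
      using that by (simp add: prime_elem_multiplicity_mult_distrib
          prime_elem_multiplicity_power_distrib)
    moreover have "multiplicity p M \<le> 1"
      using that by (auto simp: squarefree_factorial_semiring'' prime_elem_nat_iff)
    ultimately show ?thesis by simp
  qed
  obtain K L where sq: "K > 0" "L > 0" "m = K\<^sup>2 * L" "squarefree L"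
  proof (rule that)
    show "square_part m > 0" "squarefree_part m > 0"
      using assms by (simp_all flip: neq0_conv)
    show "m = (square_part m)\<^sup>2 * squarefree_part m"
      by (subst mult.commute) (rule squarefree_decompose)
    show "squarefree (squarefree_part m)"
      by (rule squarefree_squarefree_part)
  qed
  show ?thesis
  proof (rule ex1I[of _ "(K, L)"])
    show "case (K, L) of (N, M) \<Rightarrow> N > 0 \<and> M > 0 \<and> m = N\<^sup>2 * M \<and> squarefree M"
      using sq by blast
  next
    fix z :: "nat \<times> nat"
    assume "case z of (N, M) \<Rightarrow> N > 0 \<and> M > 0 \<and> m = N\<^sup>2 * M \<and> squarefree M"
    then obtain N M where z: "z = (N, M)" "N > 0" "M > 0" "m = N\<^sup>2 * M" "squarefree M"
      by (cases z) blast
    have eq: "N = K"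
      by (rule multiplicity_eq_nat[OF z(2) sq(1)]) (simp only: mult[OF z(2-5)] mult[OF sq])
    have "K\<^sup>2 * M = K\<^sup>2 * L"
      using z(4) sq(3) unfolding eq by (rule trans[OF sym])
    then have "M = L"
      using sq(1) by simp
    then show "z = (K, L)"
      using z(1) eq by blast
  qed
qed

end

theory Submission
  imports Defs "HOL-Computational_Algebra.Formal_Power_Series"
begin

text \<open>
  Write \<open>\<phi>(q) = \<Sum>\<^sub>k q^(k\<^sup>2)\<close> over all integers \<open>k\<close> and \<open>\<psi>(q) = \<Sum>\<^sub>k q^(k(k+1)/2)\<close> over \<open>k \<ge> 0\<close>, and let
  \<open>D\<close> be the generating function of partitions with distinct even parts. Gauss' product formulas
  for \<open>\<phi>\<close> and \<open>\<psi>\<close> give \<open>D(-q) \<phi>(q) = \<psi>(q)\<close>. Since \<open>\<phi> \<equiv> 1 (mod 2)\<close>, we have \<open>\<phi>^4 \<equiv> 1 (mod 8)\<close>, so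
  \<open>D(-q)\<^sup>2 \<equiv> \<phi>(q)\<^sup>2 \<psi>(q)\<^sup>2 (mod 8)\<close>. The right-hand side collects the even-indexed coefficients of
  \<open>\<psi>(q)^4 = \<Sum>\<^sub>n \<sigma>(2n+1) q^n\<close>, hence \<open>(-1)^n ped\<^sub>-\<^sub>2(n) \<equiv> \<sigma>(4n+1) (mod 8)\<close>, and the multiplicativity
  of \<open>\<sigma>\<close> yields the classification. The formula for \<open>\<psi>^4\<close> is obtained by comparing logarithmic
  derivatives, which amounts to \<open>\<Sum> y (yz - x\<^sup>2) = 0\<close> over the solutions of \<open>x\<^sup>2 + 4yz = 8n+5\<close>
  with \<open>y, z > 0\<close>; this follows from Zagier's involution.
\<close>

unbundle fps_syntax

section \<open>Enumerators\<close>

definition enumerator :: "'a set \<Rightarrow> ('a \<Rightarrow> nat) \<Rightarrow> int fps" where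
  "enumerator S w = Abs_fps (\<lambda>n. int (card {x \<in> S. w x = n}))"

text \<open>\<open>card\<close> of an infinite set is 0, so a coefficient of
  \<open>enumerator\<close> is a genuine count only when the fibre is finite; the sum and product
  rules rest on this.\<close>

definition finite_fibres :: "'a set \<Rightarrow> ('a \<Rightarrow> nat) \<Rightarrow> bool" where
  "finite_fibres S w \<longleftrightarrow> (\<forall>n. finite {x \<in> S. w x = n})"

lemma enumerator_nth: "enumerator S w $ n = int (card {x \<in> S. w x = n})"
  by (simp add: enumerator_def)

lemma finite_fibresD: "finite_fibres S w \<Longrightarrow> finite {x \<in> S. w x = n}"
  by (simp add: finite_fibres_def)

lemma finite_fibres_subset: "finite_fibres S w \<Longrightarrow> T \<subseteq> S \<Longrightarrow> finite_fibres T w"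
  unfolding finite_fibres_def
  by (intro allI, rule finite_subset[of _ "{x \<in> S. w x = n}" for n]) auto

lemma fibre_Times:
  fixes w :: "'a \<Rightarrow> nat" and v :: "'b \<Rightarrow> nat"
  shows "{p \<in> S \<times> T. (case p of (x, y) \<Rightarrow> w x + v y) = n} =
     (\<Union>i\<in>{0..n}. {x \<in> S. w x = i} \<times> {y \<in> T. v y = n - i})"
  by auto

lemma finite_fibres_Times:
  "finite_fibres S w \<Longrightarrow> finite_fibres T v \<Longrightarrow> finite_fibres (S \<times> T) (\<lambda>(x, y). w x + v y)"
  unfolding finite_fibres_def fibre_Times by (intro allI finite_UN_I finite_cartesian_product) auto

lemma enumerator_mult:
  assumes "finite_fibres S w" "finite_fibres T v"
  shows "enumerator S w * enumerator T v = enumerator (S \<times> T) (\<lambda>(x, y). w x + v y)"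
proof (rule fps_ext)
  fix n
  have "card (\<Union>i\<in>{0..n}. {x \<in> S. w x = i} \<times> {y \<in> T. v y = n - i}) =
    (\<Sum>i=0..n. card ({x \<in> S. w x = i} \<times> {y \<in> T. v y = n - i}))"
    using assms by (intro card_UN_disjoint) (auto simp: finite_fibres_def)
  then show "(enumerator S w * enumerator T v) $ n =
      enumerator (S \<times> T) (\<lambda>(x, y). w x + v y) $ n"
    by (simp only: fps_mult_nth enumerator_nth fibre_Times) (simp add: card_cartesian_product)
qed

lemma enumerator_Un:
  assumes "finite_fibres S w" "finite_fibres T w" "S \<inter> T = {}"
  shows "enumerator (S \<union> T) w = enumerator S w + enumerator T w"
proof (rule fps_ext)
  fix n
  have eq: "{x \<in> S \<union> T. w x = n} = {x \<in> S. w x = n} \<union> {x \<in> T. w x = n}" by auto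
  then show "enumerator (S \<union> T) w $ n = (enumerator S w + enumerator T w) $ n"
  proof -
    have "card ({x \<in> S. w x = n} \<union> {x \<in> T. w x = n}) = card {x \<in> S. w x = n} + card {x \<in> T. w x = n}"
      using assms by (intro card_Un_disjoint finite_fibresD) auto
    then show ?thesis using eq by (simp add: enumerator_nth)
  qed
qed

lemma enumerator_bij:
  assumes "bij_betw g S T" "\<And>x. x \<in> S \<Longrightarrow> v (g x) = w x"
  shows "enumerator S w = enumerator T v"
proof (rule fps_ext)
  fix n
  have "bij_betw g {x \<in> S. w x = n} {y \<in> T. v y = n}"
    using assms by (auto simp: bij_betw_def inj_on_def)
  then show "enumerator S w $ n = enumerator T v $ n"
    by (simp add: enumerator_nth bij_betw_same_card)
qed

lemma enumerator_shift:
  "enumerator S (\<lambda>x. k + w x) = fps_X ^ k * enumerator S w"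
proof (rule fps_ext)
  fix n
  have "{x \<in> S. k + w x = n} = (if k \<le> n then {x \<in> S. w x = n - k} else {})" by auto
  then show "enumerator S (\<lambda>x. k + w x) $ n = (fps_X ^ k * enumerator S w) $ n"
    by (simp add: enumerator_nth fps_X_power_mult_nth)
qed

section \<open>Finite forms of Gauss' product formulas\<close>

definition tri :: "nat \<Rightarrow> nat" where "tri k = k * (k + 1) div 2"

lemma two_tri: "2 * tri k = k * (k + 1)"
  by (simp add: tri_def)

lemma tri_0 [simp]: "tri 0 = 0" by (simp add: tri_def)

lemma tri_Suc: "tri (Suc k) = tri k + Suc k"
  using two_tri[of k] two_tri[of "Suc k"] by (simp add: algebra_simps)

lemma tri_mono: "a \<le> b \<Longrightarrow> tri a \<le> tri b"
  by (induction rule: dec_induct) (auto simp: tri_Suc)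

lemma le_tri: "k \<le> tri k" by (induction k) (auto simp: tri_Suc)

lemma tri_inj: "tri a = tri b \<Longrightarrow> a = b"
proof (induction a b rule: linorder_wlog)
  case (le a b)
  show ?case
  proof (rule ccontr)
    assume "a \<noteq> b"
    then have "tri (Suc a) \<le> tri b" using le by (intro tri_mono) auto
    then show False using le by (simp add: tri_Suc)
  qed
qed simp

text \<open>
  Shanks' finite identities, multiplied by the common denominator so that they hold in every
  commutative ring. Modulo high powers of \<open>q\<close> only the summand \<open>s = 0\<close> on the left survives.
\<close>

lemma shanks_triangular:
  fixes q :: "'a::comm_ring_1"
  defines "A \<equiv> \<lambda>n. \<Prod>k=1..n. 1 - q ^ (2 * k - 1)"
  defines "B \<equiv> \<lambda>s n. \<Prod>k=Suc s..n. 1 - q ^ (2 * k)"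
  shows "(\<Sum>s\<le>n. A s * B s n * q ^ (s * (2 * n + 1))) = A n * (\<Sum>s\<le>2 * n. q ^ tri s)"
proof (induction n)
  case 0
  show ?case by (simp add: A_def B_def)
next
  case (Suc n)
  have A: "A (Suc s) = A s * (1 - q ^ (2 * s + 1))" for s by (simp add: A_def)
  have B_Suc: "B s (Suc n) = B s n * (1 - q ^ (2 * Suc n))" if "s \<le> n" for s
    using that by (simp add: B_def)
  have BB: "B n n = 1" for n by (simp add: B_def)
  \<comment> \<open>Telescoping certificate: passing from \<open>n\<close> to \<open>Suc n\<close>
    multiplies each summand by \<open>1 - q ^ (2 * n + 1)\<close> up to the difference
    \<open>V (Suc s) - V s\<close>. The value 0 at \<open>s = 0\<close> replaces a product that
    would start at \<open>k = 0\<close> and so contain the factor \<open>1 - q ^ 0\<close>.\<close>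
  define V where "V s = (if s = 0 then 0 else A s * B (s - 1) n * q ^ (s * (2 * n + 1)))" for s
  have step: "A s * B s (Suc n) * q ^ (s * (2 * Suc n + 1)) =
     (1 - q ^ (2 * n + 1)) * (A s * B s n * q ^ (s * (2 * n + 1))) + (V (Suc s) - V s)"
    if "s \<le> n" for s
  proof -
    have 1: "V s = A s * B s n * (1 - q ^ (2 * s)) * q ^ (s * (2 * n + 1))"
    proof (cases s)
      case (Suc r)
      then have "B r n = B s n * (1 - q ^ (2 * s))"
        using that unfolding B_def by (subst prod.atLeast_Suc_atMost) (auto simp: mult.commute)
      then show ?thesis using Suc by (simp add: V_def)
    qed (simp add: V_def)
    have 2: "V (Suc s) = A s * (1 - q ^ (2 * s + 1)) * B s n *
        (q ^ (s * (2 * n + 1)) * q ^ (2 * n + 1))"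
      unfolding V_def A by (simp add: mult_Suc power_add mult.assoc mult.left_commute del: One_nat_def)
    have 3: "q ^ (s * (2 * Suc n + 1)) = q ^ (s * (2 * n + 1)) * q ^ (2 * s)"
      by (simp add: power_add[symmetric] algebra_simps)
    have 4: "q ^ (2 * Suc n) = q * q ^ (2 * n + 1)" "q ^ (2 * s + 1) = q * q ^ (2 * s)" by simp_all
    \<comment> \<open>The claim with \<open>a = q ^ (2 * s)\<close>,
      \<open>b = q ^ (2 * n + 1)\<close> and \<open>e = q ^ (s * (2 * n + 1))\<close>, which makes
      it a polynomial identity.\<close>
    have "x * (y * (1 - q * b)) * (e * a) = (1 - b) * (x * y * e) +
        (x * (1 - q * a) * y * (e * b) - x * y * (1 - a) * e)" for x y a b e :: 'a
      by (simp add: algebra_simps)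
    then show ?thesis
      unfolding 1 2 3 B_Suc[OF that] 4 .
  qed
  have tele: "(\<Sum>s\<le>m. V (Suc s) - V s) = V (Suc m) - V 0" for m
    by (induction m) simp_all
  have "(\<Sum>s\<le>n. A s * B s (Suc n) * q ^ (s * (2 * Suc n + 1))) =
      (\<Sum>s\<le>n. (1 - q ^ (2 * n + 1)) * (A s * B s n * q ^ (s * (2 * n + 1))) + (V (Suc s) - V s))"
    by (intro sum.cong refl step) auto
  also have "\<dots> = (1 - q ^ (2 * n + 1)) * (\<Sum>s\<le>n. A s * B s n * q ^ (s * (2 * n + 1))) + (V (Suc n) - V 0)"
    by (simp only: sum.distrib sum_distrib_left tele)
  also have "V 0 = 0" by (simp add: V_def)
  also note Suc.IH
  finally have "(\<Sum>s\<le>Suc n. A s * B s (Suc n) * q ^ (s * (2 * Suc n + 1))) =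
     (1 - q ^ (2 * n + 1)) * (A n * (\<Sum>s\<le>2 * n. q ^ tri s)) + V (Suc n)
       + A (Suc n) * q ^ (Suc n * (2 * Suc n + 1))"
    by (simp only: sum.atMost_Suc BB mult_1_right diff_zero)
  \<comment> \<open>The boundary term and the new summand \<open>s = Suc n\<close> supply the two
    new triangular powers, with exponents \<open>tri (2 * n + 1)\<close> and
    \<open>tri (2 * n + 2)\<close>.\<close>
  also have "V (Suc n) = A (Suc n) * q ^ tri (Suc (2 * n))"
  proof -
    have "tri (Suc (2 * n)) = Suc n * (2 * n + 1)" using two_tri[of "Suc (2 * n)"] by simp
    then show ?thesis by (simp add: V_def BB)
  qed
  also have "Suc n * (2 * Suc n + 1) = tri (Suc (Suc (2 * n)))"
    using two_tri[of "Suc (Suc (2 * n))"] by simp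
  finally show ?case by (simp add: A algebra_simps)
qed

text \<open>The same telescoping as in the triangular case, now with ratio
  \<open>1 + q ^ (n + 1)\<close>. It is used at \<open>q = - fps_X\<close>, where the signs on the
  right disappear and the last factor becomes a truncation of \<phi>.\<close>

lemma shanks_square:
  fixes q :: "'a::comm_ring_1"
  defines "A \<equiv> \<lambda>n. \<Prod>k<n. 1 + q ^ k"
  defines "B \<equiv> \<lambda>s n. \<Prod>k=Suc s..n. 1 - q ^ k"
  shows "(\<Sum>s\<le>n. (-1) ^ s * A s * B s n * q ^ (s * (n + 1))) =
    (\<Prod>k=1..n. 1 + q ^ k) * (1 + 2 * (\<Sum>s=1..n. (-1) ^ s * q ^ s\<^sup>2))"
proof (induction n)
  case 0
  show ?case by (simp add: A_def B_def)
next
  case (Suc n)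
  have A: "A (Suc s) = A s * (1 + q ^ s)" for s by (simp add: A_def)
  \<comment> \<open>The product \<open>A\<close> starts at \<open>k = 0\<close> with the factor
    \<open>1 + q ^ 0 = 2\<close>; this is the source of the coefficient 2 in the theta sum.\<close>
  have A': "A (Suc n) = 2 * (\<Prod>k=1..n. 1 + q ^ k)" for n
    unfolding A_def by (induction n) (simp_all add: mult.assoc)
  have B_Suc: "B s (Suc n) = B s n * (1 - q ^ (Suc n))" if "s \<le> n" for s
    using that by (simp add: B_def)
  have BB: "B n n = 1" for n by (simp add: B_def)
  define V where "V s = (if s = 0 then 0 else (-1) ^ s * A s * B (s - 1) n * q ^ (s * (n + 1)))" for s
  have step: "(-1) ^ s * A s * B s (Suc n) * q ^ (s * (Suc n + 1)) =
     (1 + q ^ (n + 1)) * ((-1) ^ s * A s * B s n * q ^ (s * (n + 1))) + (V (Suc s) - V s)"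
    if "s \<le> n" for s
  proof -
    have 1: "V s = (-1) ^ s * A s * B s n * (1 - q ^ s) * q ^ (s * (n + 1))"
    proof (cases s)
      case (Suc r)
      then have "B r n = B s n * (1 - q ^ s)"
        using that unfolding B_def by (subst prod.atLeast_Suc_atMost) (auto simp: mult.commute)
      then show ?thesis using Suc by (simp add: V_def)
    qed (simp add: V_def)
    have 2: "V (Suc s) = - ((-1) ^ s * A s * (1 + q ^ s) * B s n *
        (q ^ (s * (n + 1)) * q ^ (n + 1)))"
      unfolding V_def A by (simp add: power_add mult.assoc mult.left_commute)
    have 3: "q ^ (s * (Suc n + 1)) = q ^ (s * (n + 1)) * q ^ s"
      by (simp add: power_add[symmetric] algebra_simps)
    have 4: "q ^ Suc n = q ^ (n + 1)" by simp
    have "x * (y * (1 - b)) * (e * a) = (1 + b) * (x * y * e) +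
        (- (x * (1 + a) * y * (e * b)) - x * y * (1 - a) * e)" for x y a b e :: 'a
      by (simp add: algebra_simps)
    then show ?thesis
      unfolding 1 2 3 B_Suc[OF that] 4 .
  qed
  have tele: "(\<Sum>s\<le>m. V (Suc s) - V s) = V (Suc m) - V 0" for m
    by (induction m) simp_all
  have "(\<Sum>s\<le>n. (-1) ^ s * A s * B s (Suc n) * q ^ (s * (Suc n + 1))) =
      (\<Sum>s\<le>n. (1 + q ^ (n + 1)) * ((-1) ^ s * A s * B s n * q ^ (s * (n + 1))) + (V (Suc s) - V s))"
    by (intro sum.cong refl step) auto
  also have "\<dots> = (1 + q ^ (n + 1)) * (\<Sum>s\<le>n. (-1) ^ s * A s * B s n * q ^ (s * (n + 1))) + (V (Suc n) - V 0)"
    by (simp only: sum.distrib sum_distrib_left tele)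
  also have "V 0 = 0" by (simp add: V_def)
  also note Suc.IH
  finally have "(\<Sum>s\<le>Suc n. (-1) ^ s * A s * B s (Suc n) * q ^ (s * (Suc n + 1))) =
     (1 + q ^ (n + 1)) * ((\<Prod>k=1..n. 1 + q ^ k) * (1 + 2 * (\<Sum>s=1..n. (-1) ^ s * q ^ s\<^sup>2)))
      + (V (Suc n) + (-1) ^ Suc n * A (Suc n) * q ^ (Suc n * (Suc n + 1)))"
    by (simp only: sum.atMost_Suc BB mult_1_right diff_zero add.assoc)
  \<comment> \<open>The exponents of the two boundary terms differ by \<open>Suc n\<close>, so
    together they complete the product by the factor \<open>1 + q ^ Suc n\<close>.\<close>
  also have "V (Suc n) + (-1) ^ Suc n * A (Suc n) * q ^ (Suc n * (Suc n + 1)) =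
     (-1) ^ Suc n * 2 * (\<Prod>k=1..Suc n. 1 + q ^ k) * q ^ (Suc n)\<^sup>2"
  proof -
    have 1: "(-1) ^ Suc n * 2 * (\<Prod>k=1..Suc n. 1 + q ^ k) = (-1) ^ Suc n * A (Suc n) * (1 + q ^ Suc n)"
      by (simp add: A'[of n] mult.assoc)
    have 2: "V (Suc n) = (-1) ^ Suc n * A (Suc n) * q ^ (Suc n)\<^sup>2"
      by (simp add: V_def BB power2_eq_square)
    have 3: "q ^ (Suc n * (Suc n + 1)) = q ^ (Suc n)\<^sup>2 * q ^ Suc n"
      by (simp add: power_add[symmetric] power2_eq_square algebra_simps)
    show ?thesis unfolding 1 2 3 by (simp add: algebra_simps)
  qed
  finally show ?case by (simp add: algebra_simps)
qed

section \<open>Partitions with distinct even parts\<close>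

text \<open>Bounding the parts by \<open>j\<close> makes the generating function a finite product,
  built up one part size at a time.\<close>

definition ped_multisets :: "nat \<Rightarrow> nat multiset set" where
  "ped_multisets j = {A. set_mset A \<subseteq> {1..j} \<and> even_parts_distinct A}"

definition ped_partitions :: "nat multiset set" where
  "ped_partitions = {A. 0 \<notin># A \<and> even_parts_distinct A}"

lemma ped_multisets_subset: "ped_multisets j \<subseteq> ped_partitions"
  by (auto simp: ped_multisets_def ped_partitions_def)

lemma finite_fibres_ped: "finite_fibres ped_partitions sum_mset"
  unfolding finite_fibres_def ped_partitions_def
  by (auto intro!: finite_subset[OF _ finite_partitions_le])

lemma finite_fibres_ped_multisets: "finite_fibres (ped_multisets j) sum_mset"
  by (rule finite_fibres_subset[OF finite_fibres_ped ped_multisets_subset])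

lemma enumerator_ped_0: "enumerator (ped_multisets 0) sum_mset = 1"
proof -
  have "ped_multisets 0 = {{#}}"
    by (auto simp: ped_multisets_def even_parts_distinct_def)
  moreover have "{A \<in> {{#}}. \<Sum>\<^sub># A = n} = (if n = 0 then {{#}} else {})" for n :: nat
    by auto
  ultimately show ?thesis by (intro fps_ext) (simp add: enumerator_nth)
qed

text \<open>Multisets are split by whether the part \<open>Suc j\<close> occurs; removing one copy
  of it leaves an element of \<open>T\<close>. For even \<open>Suc j\<close> the set
  \<open>T\<close> is \<open>ped_multisets j\<close>, for odd \<open>Suc j\<close> it is
  \<open>ped_multisets (Suc j)\<close> itself.\<close>

lemma enumerator_add_part:
  assumes "ped_multisets (Suc j) = ped_multisets j \<union> add_mset (Suc j) ` T" "T \<subseteq> ped_multisets (Suc j)"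
  shows "enumerator (ped_multisets (Suc j)) sum_mset =
    enumerator (ped_multisets j) sum_mset + fps_X ^ Suc j * enumerator T sum_mset"
proof -
  have "ped_multisets j \<inter> add_mset (Suc j) ` T = {}"
    by (auto simp: ped_multisets_def)
  moreover have "finite_fibres (add_mset (Suc j) ` T) sum_mset"
    using assms(1) by (intro finite_fibres_subset[OF finite_fibres_ped_multisets[of "Suc j"]]) auto
  ultimately have "enumerator (ped_multisets (Suc j)) sum_mset =
      enumerator (ped_multisets j) sum_mset + enumerator (add_mset (Suc j) ` T) sum_mset"
    unfolding assms(1) by (intro enumerator_Un finite_fibres_ped_multisets)
  also have "enumerator (add_mset (Suc j) ` T) sum_mset = enumerator T (\<lambda>A. Suc j + sum_mset A)"
    by (rule enumerator_bij[symmetric, of "add_mset (Suc j)"]) (auto simp: bij_betw_def inj_on_def)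
  finally show ?thesis by (simp only: enumerator_shift)
qed

lemma even_parts_distinct_add:
  "even_parts_distinct (add_mset k A) \<longleftrightarrow> even_parts_distinct A \<and> (even k \<longrightarrow> k \<notin># A)"
proof (cases "even k")
  case True
  then show ?thesis
    unfolding even_parts_distinct_def not_in_iff
    by (metis One_nat_def Suc_le_mono count_add_mset le_0_eq le_SucI)
next
  case False
  then show ?thesis unfolding even_parts_distinct_def by (metis count_add_mset)
qed

lemma ped_multisets_Suc_cases:
  assumes "A \<in> ped_multisets (Suc j)" "A \<notin> ped_multisets j"
  obtains B where "A = add_mset (Suc j) B" "B \<in> ped_multisets (Suc j)" "even (Suc j) \<longrightarrow> B \<in> ped_multisets j"
proof -
  have sub: "set_mset C \<subseteq> {1..j}" if "Suc j \<notin># C" "set_mset C \<subseteq> {1..Suc j}" for C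
    using that by (simp add: atLeastAtMostSuc_conv subset_insert)
  have "Suc j \<in># A"
    using assms sub[of A] by (auto simp: ped_multisets_def)
  then obtain B where B: "A = add_mset (Suc j) B" by (blast dest: multi_member_split)
  have "set_mset B \<subseteq> {1..Suc j}" "even_parts_distinct B" "even (Suc j) \<longrightarrow> Suc j \<notin># B"
    using assms(1) unfolding B ped_multisets_def by (simp_all add: even_parts_distinct_add)
  then show ?thesis
    using that[OF B] sub[of B] unfolding ped_multisets_def mem_Collect_eq by satx
qed

lemma ped_multisets_mono: "ped_multisets j \<subseteq> ped_multisets (Suc j)"
  unfolding ped_multisets_def using atLeastatMost_subset_iff[of 1 j 1 "Suc j"] by (intro Collect_mono) auto

lemma enumerator_ped_even:
  assumes "even (Suc j)"
  shows "enumerator (ped_multisets (Suc j)) sum_mset = (1 + fps_X ^ Suc j) * enumerator (ped_multisets j) sum_mset"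
proof -
  have "ped_multisets (Suc j) = ped_multisets j \<union> add_mset (Suc j) ` ped_multisets j"
  proof
    show "ped_multisets (Suc j) \<subseteq> ped_multisets j \<union> add_mset (Suc j) ` ped_multisets j"
    proof
      fix A assume A: "A \<in> ped_multisets (Suc j)"
      show "A \<in> ped_multisets j \<union> add_mset (Suc j) ` ped_multisets j"
      proof (cases "A \<in> ped_multisets j")
        case False
        from ped_multisets_Suc_cases[OF A this] assms obtain B where
          "A = add_mset (Suc j) B" "B \<in> ped_multisets j" by metis
        then show ?thesis by blast
      qed simp
    qed
    have "add_mset (Suc j) A \<in> ped_multisets (Suc j)" if "A \<in> ped_multisets j" for A
      using that ped_multisets_mono[of j] by (auto simp: ped_multisets_def even_parts_distinct_add)
    then show "ped_multisets j \<union> add_mset (Suc j) ` ped_multisets j \<subseteq> ped_multisets (Suc j)"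
      using ped_multisets_mono[of j] by auto
  qed
  from enumerator_add_part[OF this ped_multisets_mono] show ?thesis
    by (simp only: distrib_right mult_1)
qed

text \<open>An odd part may be repeated, so the series satisfies a recursion in terms of itself. The
  geometric factor is kept as a cleared denominator.\<close>

lemma enumerator_ped_odd:
  assumes "odd (Suc j)"
  shows "(1 - fps_X ^ Suc j) * enumerator (ped_multisets (Suc j)) sum_mset = enumerator (ped_multisets j) sum_mset"
proof -
  have "ped_multisets (Suc j) = ped_multisets j \<union> add_mset (Suc j) ` ped_multisets (Suc j)"
  proof
    show "ped_multisets (Suc j) \<subseteq> ped_multisets j \<union> add_mset (Suc j) ` ped_multisets (Suc j)"
    proof
      fix A assume A: "A \<in> ped_multisets (Suc j)"
      show "A \<in> ped_multisets j \<union> add_mset (Suc j) ` ped_multisets (Suc j)"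
      proof (cases "A \<in> ped_multisets j")
        case False
        from ped_multisets_Suc_cases[OF A this] obtain B where
          "A = add_mset (Suc j) B" "B \<in> ped_multisets (Suc j)" by metis
        then show ?thesis by blast
      qed simp
    qed
    have "add_mset (Suc j) A \<in> ped_multisets (Suc j)" if "A \<in> ped_multisets (Suc j)" for A
      using that assms by (auto simp: ped_multisets_def even_parts_distinct_add)
    then show "ped_multisets j \<union> add_mset (Suc j) ` ped_multisets (Suc j) \<subseteq> ped_multisets (Suc j)"
      using ped_multisets_mono[of j] by auto
  qed
  from enumerator_add_part[OF this order_refl]
  show ?thesis unfolding left_diff_distrib mult_1 by (simp only: diff_eq_eq)
qed

text \<open>Each induction step adds one odd and one even part size, which is why the bound on the
  parts is \<open>2 * n\<close>. In the limit the generating function is the product of the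
  quotients \<open>(1 + q ^ (2 * k)) / (1 - q ^ (2 * k - 1))\<close>.\<close>

lemma enumerator_ped_prod:
  "enumerator (ped_multisets (2 * n)) sum_mset * (\<Prod>k=1..n. 1 - fps_X ^ (2 * k - 1)) =
     (\<Prod>k=1..n. 1 + fps_X ^ (2 * k))"
proof (induction n)
  case (Suc n)
  have 1: "enumerator (ped_multisets (Suc (2 * n))) sum_mset * (1 - fps_X ^ Suc (2 * n)) =
      enumerator (ped_multisets (2 * n)) sum_mset"
    using enumerator_ped_odd[of "2 * n"] by (simp only: mult.commute) simp
  have 2: "enumerator (ped_multisets (2 * Suc n)) sum_mset =
      (1 + fps_X ^ (2 * Suc n)) * enumerator (ped_multisets (Suc (2 * n))) sum_mset"
    using enumerator_ped_even[of "Suc (2 * n)"] by simp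
  have "enumerator (ped_multisets (2 * Suc n)) sum_mset * (\<Prod>k=1..Suc n. 1 - fps_X ^ (2 * k - 1)) =
     (1 + fps_X ^ (2 * Suc n)) * ((enumerator (ped_multisets (Suc (2 * n))) sum_mset * (1 - fps_X ^ Suc (2 * n))) *
       (\<Prod>k=1..n. 1 - fps_X ^ (2 * k - 1)))"
    unfolding 2 by (simp add: ac_simps)
  also have "\<dots> = (\<Prod>k=1..Suc n. 1 + fps_X ^ (2 * k))"
    unfolding 1 Suc.IH by (simp add: ac_simps)
  finally show ?case .
qed (simp add: enumerator_ped_0)

lemma enumerator_ped_nth:
  assumes "n \<le> j"
  shows "enumerator ped_partitions sum_mset $ n = enumerator (ped_multisets j) sum_mset $ n"
proof -
  have "x \<le> \<Sum>\<^sub># A" if "x \<in># A" for x and A :: "nat multiset"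
    using that by (auto dest!: multi_member_split)
  then have "{A \<in> ped_partitions. \<Sum>\<^sub># A = n} = {A \<in> ped_multisets j. \<Sum>\<^sub># A = n}"
    using assms by (fastforce simp: ped_partitions_def ped_multisets_def Suc_le_eq intro: gr0I)
  then show ?thesis by (simp add: enumerator_nth)
qed

lemma enumerator_ped2: "(enumerator ped_partitions sum_mset)\<^sup>2 $ n = int (ped2 n)"
proof -
  have "ped_bipartitions n = {p \<in> ped_partitions \<times> ped_partitions. (case p of (A, B) \<Rightarrow> \<Sum>\<^sub># A + \<Sum>\<^sub># B) = n}"
    by (auto simp: ped_bipartitions_def partition_of_def ped_partitions_def)
  then show ?thesis
    by (simp add: power2_eq_square enumerator_mult finite_fibres_ped enumerator_nth ped2_def)
qed

section \<open>Theta series\<close>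

text \<open>The series \<phi>. Summation over all integers counts every nonzero square
  twice.\<close>

definition theta_square :: "int fps" where
  "theta_square = enumerator (UNIV :: int set) (\<lambda>k. nat (k\<^sup>2))"

text \<open>The series \<psi>, indexed by natural numbers so that each triangular number occurs
  once.\<close>

definition theta_tri :: "int fps" where
  "theta_tri = enumerator UNIV tri"

text \<open>Divisibility by \<open>fps_X ^ N\<close> expresses agreement of series up to order
  \<open>N\<close>. Identities between infinite products are handled through their finite
  truncations in this form.\<close>

lemma fps_X_power_dvd_iff:
  fixes f :: "'a::comm_ring_1 fps"
  shows "fps_X ^ N dvd f \<longleftrightarrow> (\<forall>k<N. f $ k = 0)"
proof
  assume *: "\<forall>k<N. f $ k = 0"
  have "f = fps_X ^ N * fps_shift N f"
    using * by (intro fps_ext) (simp add: fps_X_power_mult_nth)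
  then show "fps_X ^ N dvd f" by (rule dvdI)
qed (auto simp: dvd_def fps_X_power_mult_nth)

text \<open>By strong induction the lower coefficients of \<open>h\<close> vanish, so coefficient
  \<open>k\<close> of \<open>u * h\<close> reduces to \<open>u $ 0 * h $ k\<close>.\<close>

lemma fps_X_power_dvd_cancel:
  fixes u h :: "'a::comm_ring_1 fps"
  assumes "u $ 0 = 1" "fps_X ^ N dvd u * h"
  shows "fps_X ^ N dvd h"
  unfolding fps_X_power_dvd_iff
proof (intro allI impI)
  fix k assume "k < N"
  then show "h $ k = 0"
  proof (induction k rule: less_induct)
    case (less k)
    have "0 = (u * h) $ k" using assms(2) less.prems by (simp add: fps_X_power_dvd_iff)
    also have "\<dots> = (\<Sum>i=0..k. u $ i * h $ (k - i))" by (simp add: fps_mult_nth)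
    also have "\<dots> = u $ 0 * h $ (k - 0)"
      using less by (intro sum.mono_neutral_cong_right[where S = "{0}", simplified]) auto
    finally show ?case using assms(1) by simp
  qed
qed

lemma sum_fps_X_powers_nth:
  assumes "finite A"
  shows "(\<Sum>s\<in>A. fps_X ^ e s) $ m = int (card {s \<in> A. e s = m})"
proof -
  have "(\<Sum>s\<in>A. fps_X ^ e s) $ m = (\<Sum>s\<in>A. if e s = m then 1 else (0 :: int))"
    unfolding fps_sum_nth by (rule sum.cong) auto
  also have "\<dots> = (\<Sum>s\<in>{s \<in> A. e s = m}. 1)"
    using assms by (rule sum.inter_filter[symmetric])
  finally show ?thesis by simp
qed

text \<open>Since \<open>s \<le> s\<^sup>2\<close>, every root of a square up to \<open>n\<close>
  has absolute value at most \<open>n\<close>, and the nonzero roots come in pairs \<open>s\<close>,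
  \<open>- s\<close>.\<close>

lemma theta_square_approx:
  "fps_X ^ (n + 1) dvd theta_square - (1 + 2 * (\<Sum>s=1..n. fps_X ^ s\<^sup>2))"
  unfolding fps_X_power_dvd_iff
proof (intro allI impI)
  fix m assume m: "m < n + 1"
  define C where "C = {s \<in> {1..n}. s\<^sup>2 = m}"
  have le: "s \<le> s\<^sup>2" for s :: nat by (simp add: power2_eq_square)
  have sub: "k \<in> int ` C \<union> (\<lambda>s. - int s) ` C \<union> (if m = 0 then {0} else {})"
    if "nat (k\<^sup>2) = m" for k :: int
  proof -
    have 1: "(nat \<bar>k\<bar>)\<^sup>2 = m" using that by (simp add: nat_power_eq[symmetric])
    show ?thesis
    proof (cases "k = 0")
      case False
      then have "nat \<bar>k\<bar> \<in> C" using 1 m le[of "nat \<bar>k\<bar>"] by (auto simp: C_def)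
      moreover have "k = int (nat \<bar>k\<bar>) \<or> k = - int (nat \<bar>k\<bar>)" by auto
      ultimately show ?thesis by blast
    qed (use that in auto)
  qed
  have "{k :: int. nat (k\<^sup>2) = m} = int ` C \<union> (\<lambda>s. - int s) ` C \<union> (if m = 0 then {0} else {})"
    (is "?L = ?R")
  proof
    show "?L \<subseteq> ?R" using sub by blast
    show "?R \<subseteq> ?L" by (auto simp: C_def nat_power_eq)
  qed
  also have "card \<dots> = card C + card C + (if m = 0 then 1 else 0)"
  proof -
    have "finite C" by (simp add: C_def)
    moreover have "int ` C \<inter> (\<lambda>s. - int s) ` C = {}" "0 \<notin> int ` C \<union> (\<lambda>s. - int s) ` C"
      by (auto simp: C_def)
    ultimately show ?thesis
      by (simp add: card_Un_disjoint card_image inj_on_def)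
  qed
  finally have "theta_square $ m = 2 * int (card C) + (if m = 0 then 1 else 0)"
    by (simp add: theta_square_def enumerator_nth)
  moreover have "(\<Sum>s=1..n. fps_X ^ s\<^sup>2) $ m = int (card C)"
    unfolding C_def by (rule sum_fps_X_powers_nth) simp
  moreover have "(2 * f) $ m = 2 * f $ m" for f :: "int fps"
    by (simp only: mult_2 fps_add_nth)
  ultimately show "(theta_square - (1 + 2 * (\<Sum>s=1..n. fps_X ^ s\<^sup>2))) $ m = 0"
    by (simp only: fps_sub_nth fps_add_nth fps_one_nth)
qed

lemma theta_tri_approx:
  "fps_X ^ (n + 1) dvd theta_tri - (\<Sum>s\<le>n. fps_X ^ tri s)"
  unfolding fps_X_power_dvd_iff
proof (intro allI impI)
  fix m assume m: "m < n + 1"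
  have "{s. tri s = m} = {s \<in> {..n}. tri s = m}"
  proof -
    have "s \<le> n" if "tri s = m" for s using le_tri[of s] m that by simp
    then show ?thesis by auto
  qed
  then show "(theta_tri - (\<Sum>s\<le>n. fps_X ^ tri s)) $ m = 0"
    by (simp add: theta_tri_def enumerator_nth sum_fps_X_powers_nth)
qed

lemma dvd_sum_minus_first:
  fixes f :: "nat \<Rightarrow> 'a::comm_ring_1"
  assumes "\<And>s. 0 < s \<Longrightarrow> s \<le> n \<Longrightarrow> d dvd f s" "f 0 = b"
  shows "d dvd (\<Sum>s\<le>n. f s) - b"
proof -
  have "(\<Sum>s\<le>n. f s) - b = (\<Sum>s\<in>{..n} - {0}. f s)"
    using assms(2) by (simp add: sum_diff1)
  then show ?thesis using assms by (auto intro!: dvd_sum)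
qed

lemma dvd_diff_trans:
  fixes a b c d :: "'a::comm_ring_1"
  assumes "d dvd a - b" "d dvd b - c"
  shows "d dvd a - c"
  using dvd_add[OF assms] by simp

text \<open>Gauss' product for \<psi> with cleared denominators. In Shanks' identity the summands
  with \<open>s > 0\<close> carry at least \<open>fps_X ^ (2 * n + 1)\<close>, and the summand
  \<open>s = 0\<close> is the product on the right.\<close>

lemma theta_tri_prod:
  "fps_X ^ (2 * n + 1) dvd
     (\<Prod>k=1..n. 1 - fps_X ^ (2 * k - 1)) * theta_tri - (\<Prod>k=1..n. 1 - fps_X ^ (2 * k))"
    (is "_ dvd ?P * _ - ?R")
proof (rule dvd_diff_trans)
  show "fps_X ^ (2 * n + 1) dvd ?P * theta_tri - ?P * (\<Sum>s\<le>2 * n. fps_X ^ tri s)"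
    unfolding right_diff_distrib[symmetric] by (intro dvd_mult theta_tri_approx)
  have "fps_X ^ (2 * n + 1) dvd (fps_X :: int fps) ^ (s * (2 * n + 1))" if "0 < s" for s
    using that mult_le_mono1[of 1 s "2 * n + 1"] by (intro le_imp_power_dvd) simp
  then show "fps_X ^ (2 * n + 1) dvd ?P * (\<Sum>s\<le>2 * n. fps_X ^ tri s) - ?R"
    unfolding shanks_triangular[symmetric]
    by (intro dvd_sum_minus_first) auto
qed

lemma prod_even_odd:
  fixes f :: "nat \<Rightarrow> 'a::comm_monoid_mult"
  shows "(\<Prod>k=1..2 * n. f k) = (\<Prod>k=1..n. f (2 * k - 1)) * (\<Prod>k=1..n. f (2 * k))"
  by (induction n) (simp_all add: ac_simps)

text \<open>Gauss' product for \<phi>, from \<open>shanks_square\<close> of length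
  \<open>2 * n\<close> at \<open>q = - fps_X\<close>. Separating even and odd indices shows which
  factors change sign.\<close>

lemma theta_square_prod:
  "fps_X ^ (2 * n + 1) dvd
     (\<Prod>k=1..n. 1 - fps_X ^ (2 * k - 1)) * (\<Prod>k=1..n. 1 + fps_X ^ (2 * k)) * theta_square
     - (\<Prod>k=1..n. 1 + fps_X ^ (2 * k - 1)) * (\<Prod>k=1..n. 1 - fps_X ^ (2 * k))"
proof -
  define q :: "int fps" where "q = - fps_X"
  \<comment> \<open>The two signs cancel because \<open>s\<close> and \<open>s\<^sup>2\<close> have
    the same parity.\<close>
  have sgn: "(-1) ^ s * q ^ s\<^sup>2 = fps_X ^ s\<^sup>2" for s
  proof -
    have "q ^ s\<^sup>2 = (-1) ^ s\<^sup>2 * fps_X ^ s\<^sup>2" unfolding q_def by (rule power_minus)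
    moreover have "even (s + s\<^sup>2)" by simp
    ultimately show ?thesis by (simp add: mult.assoc[symmetric] power_add[symmetric])
  qed
  have odd: "q ^ (2 * k - 1) = - (fps_X ^ (2 * k - 1))" if "k \<in> {1..n}" for k
    using that by (simp add: q_def)
  have even: "q ^ (2 * k) = fps_X ^ (2 * k)" for k by (simp add: q_def)
  let ?P = "\<Prod>k=1..2*n. 1 + q ^ k" and ?R = "\<Prod>k=1..2*n. 1 - q ^ k"
  have "fps_X ^ (2 * n + 1) dvd ?P * theta_square - ?R"
  proof (rule dvd_diff_trans)
    show "fps_X ^ (2 * n + 1) dvd ?P * theta_square - ?P * (1 + 2 * (\<Sum>s=1..2*n. fps_X ^ s\<^sup>2))"
      unfolding right_diff_distrib[symmetric] by (intro dvd_mult theta_square_approx)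
    have "fps_X ^ (2 * n + 1) dvd q ^ (s * (2 * n + 1))" if "0 < s" for s
    proof -
      have "fps_X ^ (2 * n + 1) dvd q ^ (2 * n + 1)" by (intro dvd_power_same) (simp add: q_def)
      also have "\<dots> dvd q ^ (s * (2 * n + 1))" using that mult_le_mono1[of 1 s "2 * n + 1"]
        by (intro le_imp_power_dvd) simp
      finally show ?thesis .
    qed
    then show "fps_X ^ (2 * n + 1) dvd ?P * (1 + 2 * (\<Sum>s=1..2*n. fps_X ^ s\<^sup>2)) - ?R"
      unfolding sgn[symmetric] shanks_square[symmetric]
      by (intro dvd_sum_minus_first) auto
  qed
  moreover have "?P = (\<Prod>k=1..n. 1 - fps_X ^ (2 * k - 1)) * (\<Prod>k=1..n. 1 + fps_X ^ (2 * k))"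
    unfolding prod_even_odd even by (simp only: odd diff_minus_eq_add add_uminus_conv_diff cong: prod.cong)
  moreover have "?R = (\<Prod>k=1..n. 1 + fps_X ^ (2 * k - 1)) * (\<Prod>k=1..n. 1 - fps_X ^ (2 * k))"
    unfolding prod_even_odd even by (simp only: odd diff_minus_eq_add add_uminus_conv_diff cong: prod.cong)
  ultimately show ?thesis by (simp only: mult.assoc)
qed

section \<open>The series D(-q), its relation to the theta series, and reduction modulo 8\<close>

definition ped_alt :: "int fps" where
  "ped_alt = enumerator ped_partitions sum_mset oo (- fps_X)"

lemma fps_compose_uminus_nth: "(f oo (- fps_X :: 'a::comm_ring_1 fps)) $ n = (-1) ^ n * f $ n"
proof -
  have "(- fps_X :: 'a fps) ^ i $ n = (if i = n then (-1) ^ n else 0)" for i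
  proof -
    have "(- fps_X :: 'a fps) ^ i = fps_const ((-1) ^ i) * fps_X ^ i"
      by (subst power_minus) (simp flip: fps_const_power fps_const_neg)
    then show ?thesis by (simp add: fps_X_power_nth)
  qed
  then show ?thesis
    by (simp add: fps_compose_nth mult_delta_right mult.commute)
qed

text \<open>Substituting \<open>- fps_X\<close> flips the sign of the odd powers only. The
  truncation to parts at most \<open>2 * n\<close> is correct up to order
  \<open>2 * n + 1\<close>.\<close>

lemma ped_alt_prod:
  "fps_X ^ (2 * n + 1) dvd ped_alt * (\<Prod>k=1..n. 1 + fps_X ^ (2 * k - 1)) - (\<Prod>k=1..n. 1 + fps_X ^ (2 * k))"
proof -
  define E where "E = enumerator (ped_multisets (2 * n)) sum_mset oo (- fps_X)"
  have "E * (\<Prod>k=1..n. 1 + fps_X ^ (2 * k - 1)) = (\<Prod>k=1..n. 1 + fps_X ^ (2 * k))"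
  proof -
    have c: "(- fps_X :: int fps) $ 0 = 0" by simp
    have p: "fps_X ^ k oo (- fps_X :: int fps) = (- fps_X) ^ k" for k
      by (simp only: fps_compose_power[OF c, symmetric] fps_X_fps_compose_startby0[OF c])
    have o: "(\<Prod>k=1..n. 1 - fps_X ^ (2 * k - 1)) oo (- fps_X) = (\<Prod>k=1..n. 1 + (fps_X :: int fps) ^ (2 * k - 1))"
      unfolding fps_compose_prod_distrib[OF c] by (intro prod.cong refl) (simp add: fps_compose_sub_distrib p)
    have e: "(\<Prod>k=1..n. 1 + fps_X ^ (2 * k)) oo (- fps_X) = (\<Prod>k=1..n. 1 + (fps_X :: int fps) ^ (2 * k))"
      unfolding fps_compose_prod_distrib[OF c] by (intro prod.cong refl) (simp add: fps_compose_add_distrib p)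
    show ?thesis
      using arg_cong[OF enumerator_ped_prod[of n], of "\<lambda>f. f oo (- fps_X)"]
      by (simp only: fps_compose_mult_distrib[OF c] o e E_def)
  qed
  moreover have "fps_X ^ (2 * n + 1) dvd ped_alt - E"
    unfolding fps_X_power_dvd_iff
    by (simp add: ped_alt_def E_def fps_compose_uminus_nth enumerator_ped_nth)
  then have "fps_X ^ (2 * n + 1) dvd (ped_alt - E) * (\<Prod>k=1..n. 1 + fps_X ^ (2 * k - 1))"
    by (rule dvd_mult2)
  ultimately show ?thesis by (simp add: left_diff_distrib)
qed

lemma ped_alt_theta: "ped_alt * theta_square = theta_tri"
proof (rule fps_ext)
  fix n
  define P1 E1 P3 R3 :: "int fps" where "P1 = (\<Prod>k=1..n. 1 + fps_X ^ (2 * k - 1))"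
    and "E1 = (\<Prod>k=1..n. 1 + fps_X ^ (2 * k))" and "P3 = (\<Prod>k=1..n. 1 - fps_X ^ (2 * k - 1))"
    and "R3 = (\<Prod>k=1..n. 1 - fps_X ^ (2 * k))"
  let ?N = "2 * n + 1"
  have 1: "fps_X ^ ?N dvd ped_alt * P1 - E1" unfolding P1_def E1_def by (rule ped_alt_prod)
  have 2: "fps_X ^ ?N dvd P3 * E1 * theta_square - P1 * R3"
    unfolding P1_def E1_def P3_def R3_def by (rule theta_square_prod)
  have 3: "fps_X ^ ?N dvd P3 * theta_tri - R3"
    unfolding P3_def R3_def by (rule theta_tri_prod)
  \<comment> \<open>The multipliers are chosen so that all terms without the common factor
    \<open>P1 * P3 * E1\<close> cancel. That factor has constant term 1 and can then be
    removed.\<close>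
  have "fps_X ^ ?N dvd (ped_alt * P1 - E1) * (P3 * E1 * theta_square)
      + E1 * (P3 * E1 * theta_square - P1 * R3) - P1 * E1 * (P3 * theta_tri - R3)"
    by (intro dvd_diff dvd_add dvd_mult dvd_mult2 1 2 3)
  also have "\<dots> = (P1 * P3 * E1) * (ped_alt * theta_square - theta_tri)"
    by (simp add: algebra_simps)
  finally have "fps_X ^ ?N dvd ped_alt * theta_square - theta_tri"
  proof (rule fps_X_power_dvd_cancel[rotated])
    have one: "(\<Prod>k\<in>A. f k) $ 0 = 1" if "\<And>k. k \<in> A \<Longrightarrow> f k $ 0 = 1" for A :: "nat set" and f :: "nat \<Rightarrow> int fps"
      using that by (induction A rule: infinite_finite_induct) auto
    have "P1 $ 0 = 1" "P3 $ 0 = 1" "E1 $ 0 = 1"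
      unfolding P1_def P3_def E1_def by (rule one; simp)+
    then show "(P1 * P3 * E1) $ 0 = 1" by simp
  qed
  from this[unfolded fps_X_power_dvd_iff, rule_format, of n]
  show "(ped_alt * theta_square) $ n = theta_tri $ n" by simp
qed

lemma theta_square_pow4: "\<exists>K. theta_square ^ 4 = 1 + 8 * K"
proof -
  have "\<exists>S. theta_square = 1 + 2 * S"
  proof
    \<comment> \<open>The halving is exact: comparing coefficient \<open>m\<close> with the
      truncation of length \<open>m\<close> shows that \<open>theta_square - 1\<close> has even
      coefficients.\<close>
    show "theta_square = 1 + 2 * Abs_fps (\<lambda>m. (theta_square - 1) $ m div 2)"
    proof (rule fps_ext)
      fix m
      have two: "(2 * f) $ m = 2 * f $ m" for f :: "int fps"
        by (simp only: mult_2 fps_add_nth)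
      have "(theta_square - (1 + 2 * (\<Sum>s=1..m. fps_X ^ s\<^sup>2))) $ m = 0"
        using theta_square_approx[of m] by (simp only: fps_X_power_dvd_iff)
      then have "even ((theta_square - 1) $ m)" by (simp add: two del: One_nat_def)
      then show "theta_square $ m = (1 + 2 * Abs_fps (\<lambda>m. (theta_square - 1) $ m div 2)) $ m"
        by (simp add: two del: fps_sub_nth) simp
    qed
  qed
  then obtain S where S: "theta_square = 1 + 2 * S" by blast
  \<comment> \<open>The witness is read off from the binomial expansion of
    \<open>(1 + 2 * S) ^ 4\<close>.\<close>
  show ?thesis
    by (rule exI[of _ "S + 3 * S\<^sup>2 + 4 * S ^ 3 + 2 * S ^ 4"])
      (simp add: S power4_eq_xxxx power3_eq_cube power2_eq_square algebra_simps)
qed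

text \<open>Replacing \<psi> by \<open>ped_alt * theta_square\<close> turns the right-hand series
  into \<open>ped_alt\<^sup>2 * theta_square ^ 4\<close>, whose last factor is 1 modulo 8.\<close>

lemma ped2_cong:
  "[(-1) ^ n * int (ped2 n) = (theta_square\<^sup>2 * theta_tri\<^sup>2) $ n] (mod 8)"
proof -
  obtain K where K: "theta_square ^ 4 = 1 + 8 * K" using theta_square_pow4 by blast
  have "theta_square\<^sup>2 * theta_tri\<^sup>2 = ped_alt\<^sup>2 * theta_square ^ 4"
    unfolding ped_alt_theta[symmetric] by (simp add: power_mult_distrib flip: power_add)
  also have "\<dots> = ped_alt\<^sup>2 + 8 * (ped_alt\<^sup>2 * K)" by (simp add: K algebra_simps)
  finally have "(theta_square\<^sup>2 * theta_tri\<^sup>2) $ n = (ped_alt\<^sup>2) $ n + 8 * (ped_alt\<^sup>2 * K) $ n"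
    by (simp add: numeral_fps_const)
  moreover have "(ped_alt\<^sup>2) $ n = (-1) ^ n * int (ped2 n)"
    unfolding ped_alt_def by (subst fps_compose_power) (simp_all add: fps_compose_uminus_nth enumerator_ped2)
  ultimately show ?thesis by (simp add: cong_def)
qed

section \<open>Zagier's involution\<close>

text \<open>Equivalently, the binary quadratic forms with coefficients \<open>y\<close>,
  \<open>x\<close>, \<open>- z\<close> and discriminant \<open>N\<close> whose outer coefficients
  have these fixed signs; \<open>x\<close> may have either sign.\<close>

definition zagier :: "int \<Rightarrow> (int \<times> int \<times> int) set" where
  "zagier N = {(y, x, z). y > 0 \<and> z > 0 \<and> x\<^sup>2 + 4 * y * z = N}"

lemma abs_le_square_int: "\<bar>x\<bar> \<le> x\<^sup>2" for x :: int
proof (cases "x = 0")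
  case False
  then have "\<bar>x\<bar> * 1 \<le> \<bar>x\<bar> * \<bar>x\<bar>" by (intro mult_left_mono) auto
  then show ?thesis by (simp add: power2_eq_square abs_mult_self_eq)
qed simp

lemma finite_zagier: "finite (zagier N)"
proof (rule finite_subset)
  show "zagier N \<subseteq> {-N..N} \<times> {-N..N} \<times> {-N..N}"
  proof
    fix t assume "t \<in> zagier N"
    then obtain y x z where t: "t = (y, x, z)" and *: "y > 0" "z > 0" "x\<^sup>2 + 4 * y * z = N"
      by (auto simp: zagier_def)
    have 1: "y * 1 \<le> y * z" "1 * z \<le> y * z"
      using * by (auto intro!: mult_mono)
    have 2: "\<bar>x\<bar> \<le> x\<^sup>2" by (rule abs_le_square_int)
    have 3: "x\<^sup>2 \<ge> 0" by simp
    have 4: "N = x\<^sup>2 + 4 * (y * z)" using * by simp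
    have "- N \<le> y \<and> y \<le> N" "- N \<le> x \<and> x \<le> N" "- N \<le> z \<and> z \<le> N"
      using *(1,2) 1 2 3 unfolding 4 by linarith+
    then show "t \<in> {-N..N} \<times> {-N..N} \<times> {-N..N}" by (simp add: t)
  qed
qed simp

text \<open>Swapping \<open>y\<close> and \<open>z\<close> reduces the sum to the half
  \<open>A\<close>, where an involution makes the suitably corrected summand cancel. For
  \<open>N = 8 * n + 5\<close> this becomes a convolution of \<psi> with divisor sums.\<close>

lemma zagier_sum:
  assumes N: "N mod 8 = (5::int)"
  shows "(\<Sum>(y, x, z)\<in>zagier N. y * (y * z - x\<^sup>2)) = 0"
proof -
  define S where "S = zagier N"
  define A where "A = {(y, x, z) \<in> S. z > x + y}"
  have fin: "finite S" "A \<subseteq> S" using finite_zagier[of N] by (auto simp: S_def A_def)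
  \<comment> \<open>On the wall \<open>z = x + y\<close> the number \<open>N\<close> would be the
    square of \<open>x + 2 * y\<close>, but 5 is not a square modulo 8.\<close>
  have ne: "z \<noteq> x + y" if "(y, x, z) \<in> S" for x y z
  proof
    assume "z = x + y"
    then have "(x + 2 * y)\<^sup>2 = N"
      using that by (auto simp: S_def zagier_def power2_eq_square algebra_simps)
    moreover have "w\<^sup>2 mod 8 \<noteq> 5" for w :: int
    proof -
      have "w mod 8 = 0 \<or> w mod 8 = 1 \<or> w mod 8 = 2 \<or> w mod 8 = 3 \<or>
          w mod 8 = 4 \<or> w mod 8 = 5 \<or> w mod 8 = 6 \<or> w mod 8 = 7"
        by presburger
      then have "(w mod 8)\<^sup>2 mod 8 \<noteq> 5" by auto
      then show ?thesis by (simp add: power_mod)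
    qed
    ultimately show False using N by blast
  qed
  have comp: "S - A = {(y, x, z) \<in> S. z < x + y}"
  proof -
    have "(y, x, z) \<in> S - A \<longleftrightarrow> (y, x, z) \<in> S \<and> z < x + y" for x y z
      using ne[of y x z] by (auto simp: A_def)
    then show ?thesis by auto
  qed
  text \<open>The half of \<open>S\<close> not in \<open>A\<close> is the image of \<open>A\<close> under \<open>(y, x, z) \<mapsto> (z, -x, y)\<close>.\<close>
  have split: "(\<Sum>(y, x, z)\<in>S. f y x z) = (\<Sum>(y, x, z)\<in>A. f y x z + f z (- x) y)"
    for f :: "int \<Rightarrow> int \<Rightarrow> int \<Rightarrow> int"
  proof -
    have "(\<Sum>(y, x, z)\<in>S - A. f y x z) = (\<Sum>(y, x, z)\<in>A. f z (- x) y)"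
      unfolding comp
      by (rule sum.reindex_bij_witness[of _ "\<lambda>(y, x, z). (z, - x, y)" "\<lambda>(y, x, z). (z, - x, y)"])
        (auto simp: A_def S_def zagier_def ac_simps)
    then show ?thesis
      using sum.subset_diff[OF fin(2,1), of "\<lambda>(y, x, z). f y x z"]
      by (simp add: sum.distrib[symmetric] case_prod_unfold add.commute)
  qed
  \<comment> \<open>The map is an involution of \<open>A\<close>: the condition
    \<open>z > x + y\<close> becomes positivity of the new last entry, and positivity of
    \<open>z\<close> becomes the condition \<open>z > x + y\<close> for the image.\<close>
  have flip: "(\<Sum>(y, x, z)\<in>A. f y x z) = (\<Sum>(y, x, z)\<in>A. f y (- x - 2 * y) (z - x - y))"
    for f :: "int \<Rightarrow> int \<Rightarrow> int \<Rightarrow> int"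
    by (rule sum.reindex_bij_witness[of _ "\<lambda>(y, x, z). (y, - x - 2 * y, z - x - y)"
          "\<lambda>(y, x, z). (y, - x - 2 * y, z - x - y)"])
      (auto simp: A_def S_def zagier_def power2_eq_square algebra_simps)
  have neg: "(\<Sum>(y, x, z)\<in>S. f y x z) = (\<Sum>(y, x, z)\<in>S. f y (- x) z)"
    for f :: "int \<Rightarrow> int \<Rightarrow> int \<Rightarrow> int"
    by (rule sum.reindex_bij_witness[of _ "\<lambda>(y, x, z). (y, - x, z)" "\<lambda>(y, x, z). (y, - x, z)"])
      (auto simp: S_def zagier_def)
  text \<open>
    \<open>G\<close> is the summand symmetrised under \<open>y \<leftrightarrow> z\<close>. The correction \<open>H\<close> sums to zero because it
    comes from a function odd in \<open>x\<close>, and \<open>G - H\<close> changes sign under the involution in \<open>flip\<close>.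
  \<close>
  define G H :: "int \<Rightarrow> int \<Rightarrow> int \<Rightarrow> int"
    where "G y x z = (y + z) * (y * z - x\<^sup>2)" and "H y x z = x * (y\<^sup>2 - z\<^sup>2)" for y x z
  have "(\<Sum>(y, x, z)\<in>S. y * (y * z - x\<^sup>2)) = (\<Sum>(y, x, z)\<in>A. G y x z)"
    by (subst split, rule sum.cong) (auto simp: G_def algebra_simps)
  moreover have "(\<Sum>(y, x, z)\<in>A. H y x z) = 0"
  proof -
    have "(\<Sum>(y, x, z)\<in>S. x * y\<^sup>2) = - (\<Sum>(y, x, z)\<in>S. x * y\<^sup>2)"
      by (subst neg) (simp add: sum_negf[symmetric] case_prod_unfold)
    moreover have "(\<Sum>(y, x, z)\<in>A. H y x z) = (\<Sum>(y, x, z)\<in>S. x * y\<^sup>2)"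
      by (subst split, rule sum.cong) (auto simp: H_def algebra_simps)
    ultimately show ?thesis by simp
  qed
  moreover have "(\<Sum>(y, x, z)\<in>A. G y x z - H y x z) = - (\<Sum>(y, x, z)\<in>A. G y x z - H y x z)"
    unfolding sum_negf[symmetric]
    by (subst flip, rule sum.cong) (auto simp: G_def H_def power2_eq_square algebra_simps)
  ultimately show ?thesis
    unfolding S_def by (simp add: sum_subtractf case_prod_unfold)
qed

section \<open>Dissection of the fourth power of the triangular theta series\<close>

text \<open>Triangular numbers indexed by all integers. Each value is taken twice, at
  \<open>k\<close> and \<open>- 1 - k\<close>, and the changes of variables below become affine maps
  of the integers.\<close>

definition triz :: "int \<Rightarrow> nat" where
  "triz k = nat (k * (k + 1) div 2)"

lemma two_triz: "2 * int (triz k) = k * (k + 1)"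
proof -
  have "k * (k + 1) \<ge> 0" by (cases "k \<ge> 0") (auto simp: mult_nonpos_nonpos)
  then show ?thesis by (simp add: triz_def)
qed

lemma triz_eqI: "k * (k + 1) = l * (l + 1) \<Longrightarrow> triz k = triz l"
  by (simp add: triz_def)

lemma triz_int [simp]: "triz (int k) = tri k"
proof -
  have "2 * int (triz (int k)) = int (2 * tri k)"
    unfolding two_triz two_tri by (simp add: algebra_simps)
  then show ?thesis by simp
qed

lemma triz_reflect: "triz (- 1 - k) = triz k"
  by (rule triz_eqI) (simp add: algebra_simps)

lemma finite_fibres_square: "finite_fibres (UNIV :: int set) (\<lambda>k. nat (k\<^sup>2))"
  unfolding finite_fibres_def
proof
  fix n
  have "{k \<in> UNIV. nat (k\<^sup>2) = n} \<subseteq> {- int n..int n}"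
  proof clarify
    fix k :: int
    have "\<bar>k\<bar> \<le> k\<^sup>2" by (rule abs_le_square_int)
    then show "k \<in> {- int (nat (k\<^sup>2))..int (nat (k\<^sup>2))}" by auto
  qed
  then show "finite {k \<in> UNIV. nat (k\<^sup>2) = n}" by (rule finite_subset) simp
qed

lemma finite_fibres_tri: "finite_fibres UNIV tri"
  unfolding finite_fibres_def
  by (intro allI, rule finite_subset[of _ "{..n}" for n]) (auto intro: le_tri)

lemma range_int_Un: "range int \<union> range (\<lambda>k. - 1 - int k) = UNIV"
proof -
  have "k \<in> range int \<union> range (\<lambda>k. - 1 - int k)" for k :: int
  proof (cases "k \<ge> 0")
    case True
    then show ?thesis by (intro UnI1 range_eqI[of _ _ "nat k"]) simp
  next
    case False
    then show ?thesis by (intro UnI2 range_eqI[of _ _ "nat (- 1 - k)"]) simp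
  qed
  then show ?thesis by (rule UNIV_eq_I[symmetric])
qed

lemma finite_fibres_triz: "finite_fibres UNIV triz"
  unfolding finite_fibres_def
proof
  fix n
  have "{k \<in> UNIV. triz k = n} \<subseteq> int ` {k \<in> UNIV. tri k = n} \<union> (\<lambda>k. - 1 - int k) ` {k \<in> UNIV. tri k = n}"
  proof
    fix k assume "k \<in> {k \<in> UNIV. triz k = n}"
    then have n: "triz k = n" by simp
    have "k \<in> range int \<union> range (\<lambda>k. - 1 - int k)" by (simp only: range_int_Un UNIV_I)
    then consider l where "k = int l" | l where "k = - 1 - int l" by (elim UnE rangeE) metis+
    then show "k \<in> int ` {k \<in> UNIV. tri k = n} \<union> (\<lambda>k. - 1 - int k) ` {k \<in> UNIV. tri k = n}"
      using n by cases (auto simp: triz_reflect)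
  qed
  then show "finite {k \<in> UNIV. triz k = n}"
    using finite_fibresD[OF finite_fibres_tri] by (meson finite_UnI finite_imageI finite_subset)
qed

lemma enumerator_triz: "enumerator UNIV triz = 2 * theta_tri"
proof -
  have "enumerator UNIV triz = enumerator (range int) triz + enumerator (range (\<lambda>k. - 1 - int k)) triz"
    unfolding range_int_Un[symmetric]
    by (intro enumerator_Un finite_fibres_subset[OF finite_fibres_triz]) auto
  also have "enumerator (range int) triz = theta_tri"
    unfolding theta_tri_def by (rule enumerator_bij[symmetric, of int]) (auto simp: bij_betw_def)
  also have "enumerator (range (\<lambda>k. - 1 - int k)) triz = theta_tri"
    unfolding theta_tri_def
    by (rule enumerator_bij[symmetric, of "\<lambda>k. - 1 - int k"]) (auto simp: bij_betw_def inj_on_def triz_reflect)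
  finally show ?thesis by simp
qed

text \<open>The mixed terms in \<open>c * d\<close> and the linear terms in \<open>c\<close>
  cancel.\<close>

lemma triz_sum:
  "triz (c + d) + triz (d - c) = nat (c\<^sup>2) + 2 * triz d"
proof -
  have "2 * int (triz (c + d) + triz (d - c)) = 2 * int (nat (c\<^sup>2) + 2 * triz d)"
    by (simp add: distrib_left two_triz) (simp add: power2_eq_square algebra_simps)
  then show ?thesis by (simp only: mult_cancel_left of_nat_eq_iff) simp
qed

lemma finite_fibres_two_triz: "finite_fibres UNIV (\<lambda>k. 2 * triz k)"
  unfolding finite_fibres_def
proof
  fix n
  show "finite {k \<in> UNIV. 2 * triz k = n}"
    by (rule finite_subset[OF _ finite_fibresD[OF finite_fibres_triz, of "n div 2"]]) auto
qed

text \<open>This is the identity \<psi>(q)^2 = \<phi>(q) \<psi>(q^2), doubled. Pairs of indices are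
  split by the parity of their sum; each half is parametrised by \<open>(c, d)\<close> through
  \<open>triz_sum\<close>, the odd half after reflecting the second index.\<close>

lemma theta_tri_square:
  "2 * theta_tri\<^sup>2 = theta_square * enumerator UNIV (\<lambda>k. 2 * triz k)"
proof -
  define w where "w = (\<lambda>(i, j). triz i + triz j)"
  define v where "v = (\<lambda>(c :: int, d). nat (c\<^sup>2) + 2 * triz d)"
  define E where "E b = {(i, j :: int). even (i + j) = b}" for b
  have w: "enumerator UNIV triz * enumerator UNIV triz = enumerator UNIV w"
    unfolding w_def by (simp add: enumerator_mult finite_fibres_triz)
  have v: "theta_square * enumerator UNIV (\<lambda>k. 2 * triz k) = enumerator UNIV v"
    unfolding v_def theta_square_def
    by (simp add: enumerator_mult finite_fibres_square finite_fibres_two_triz)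
  have fin: "finite_fibres UNIV w"
    using finite_fibres_Times[OF finite_fibres_triz finite_fibres_triz] by (simp add: w_def)
  have "enumerator UNIV w = enumerator (E True) w + enumerator (E False) w"
  proof -
    have "enumerator (E True \<union> E False) w = enumerator (E True) w + enumerator (E False) w"
      by (intro enumerator_Un finite_fibres_subset[OF fin]) (auto simp: E_def)
    moreover have "E True \<union> E False = UNIV" by (auto simp: E_def)
    ultimately show ?thesis by (simp only:)
  qed
  also have "enumerator (E True) w = enumerator UNIV v"
  proof (rule enumerator_bij[symmetric, of "\<lambda>(c, d). (c + d, d - c)"])
    show "bij_betw (\<lambda>(c, d). (c + d, d - c)) UNIV (E True)"
    proof (rule bij_betwI[where g = "\<lambda>(i, j). ((i - j) div 2, (i + j) div 2)"])
      have "even (i + j) \<Longrightarrow> (i - j) div 2 + (i + j) div 2 = i"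
        "even (i + j) \<Longrightarrow> (i + j) div 2 - (i - j) div 2 = j" for i j :: int
        by presburger+
      then show "(case case y of (i, j) \<Rightarrow> ((i - j) div 2, (i + j) div 2) of (c, d) \<Rightarrow> (c + d, d - c)) = y"
        if "y \<in> E True" for y using that by (auto simp: E_def)
    qed (auto simp: E_def)
  qed (auto simp: w_def v_def triz_sum)
  also have "enumerator (E False) w = enumerator UNIV v"
  proof (rule enumerator_bij[symmetric, of "\<lambda>(c, d). (c + d, - 1 - (d - c))"])
    show "bij_betw (\<lambda>(c, d). (c + d, - 1 - (d - c))) UNIV (E False)"
    proof (rule bij_betwI[where g = "\<lambda>(i, j). ((i + j + 1) div 2, (i - j - 1) div 2)"])
      have "odd (i + j) \<Longrightarrow> (i + j + 1) div 2 + (i - j - 1) div 2 = i"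
        "odd (i + j) \<Longrightarrow> - 1 - ((i - j - 1) div 2 - (i + j + 1) div 2) = j" for i j :: int
        by presburger+
      then show "(case case y of (i, j) \<Rightarrow> ((i + j + 1) div 2, (i - j - 1) div 2) of
          (c, d) \<Rightarrow> (c + d, - 1 - (d - c))) = y"
        if "y \<in> E False" for y using that by (auto simp: E_def)
    qed (auto simp: E_def)
    show "w ((\<lambda>(c, d). (c + d, - 1 - (d - c))) x) = v x" for x
      by (cases x) (simp only: w_def v_def prod.case triz_reflect triz_sum)
  qed
  finally have "2 * theta_tri * (2 * theta_tri) = 2 * enumerator UNIV v"
    unfolding w[symmetric] enumerator_triz by simp
  moreover have "2 * theta_tri * (2 * theta_tri) = 2 * (2 * theta_tri\<^sup>2)"
    by (simp add: power2_eq_square mult.assoc mult.left_commute)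
  ultimately have "2 * (2 * theta_tri\<^sup>2) = 2 * enumerator UNIV v" by (simp only:)
  then show ?thesis unfolding v by (simp only: mult_cancel_left) simp
qed

text \<open>Squaring the previous identity gives \<psi>(q)^4 = \<phi>(q)^2 \<psi>(q^2)^2. The second
  factor has only even exponents, so only the even part of \<phi>(q)^2 contributes, and that part is
  \<phi>(q^2)^2.\<close>

lemma theta_dissection:
  "(theta_tri ^ 4) $ (2 * n) = (theta_square\<^sup>2 * theta_tri\<^sup>2) $ n"
proof -
  define s where "s = (\<lambda>(c :: int, d :: int). nat (c\<^sup>2) + nat (d\<^sup>2))"
  define t where "t = (\<lambda>(e, f). triz e + triz f)"
  define t2 where "t2 = (\<lambda>(e, f). 2 * triz e + 2 * triz f)"
  have s: "theta_square\<^sup>2 = enumerator UNIV s" "finite_fibres UNIV s"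
    using finite_fibres_Times[OF finite_fibres_square finite_fibres_square]
    unfolding s_def theta_square_def power2_eq_square[of "enumerator _ _"]
    by (simp_all add: enumerator_mult finite_fibres_square)
  have t: "(enumerator UNIV triz)\<^sup>2 = enumerator UNIV t" "finite_fibres UNIV t"
    using finite_fibres_Times[OF finite_fibres_triz finite_fibres_triz]
    unfolding t_def power2_eq_square by (simp_all add: enumerator_mult finite_fibres_triz)
  have t2: "(enumerator UNIV (\<lambda>k. 2 * triz k))\<^sup>2 = enumerator UNIV t2" "finite_fibres UNIV t2"
    using finite_fibres_Times[OF finite_fibres_two_triz finite_fibres_two_triz]
    unfolding t2_def power2_eq_square by (simp_all add: enumerator_mult finite_fibres_two_triz)
  define w where "w = (\<lambda>(p, r). s p + t r)"
  define w2 where "w2 = (\<lambda>(p, r). s p + t2 r)"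
  \<comment> \<open>The rotation \<open>(c, d) \<mapsto> (c + d, c - d)\<close> doubles the sum of
    two squares and reaches exactly the pairs whose entries have equal parity.\<close>
  have "bij_betw (\<lambda>((c, d), r). ((c + d, c - d), r)) {x. w x = n} {x. w2 x = 2 * n}"
  proof (rule bij_betwI[where g = "\<lambda>((a, b), r). (((a + b) div 2, (a - b) div 2), r)"])
    have double: "nat ((c + d)\<^sup>2) + nat ((c - d)\<^sup>2) = 2 * (nat (c\<^sup>2) + nat (d\<^sup>2))" for c d :: int
    proof -
      have "int (nat ((c + d)\<^sup>2) + nat ((c - d)\<^sup>2)) = int (2 * (nat (c\<^sup>2) + nat (d\<^sup>2)))"
        by simp (simp add: power2_eq_square algebra_simps)
      then show ?thesis by linarith
    qed
    have w2: "w2 ((c + d, c - d), r) = 2 * w ((c, d), r)" for c d r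
      using double[of c d] by (cases r) (simp add: w_def w2_def s_def t_def t2_def)
    show "(\<lambda>((c, d), r). ((c + d, c - d), r)) \<in> {x. w x = n} \<rightarrow> {x. w2 x = 2 * n}"
      by (auto simp: w2)
    have half: "\<exists>c d. a = c + d \<and> b = c - d" if "w2 ((a, b), r) = 2 * n" for a b :: int and r
    proof -
      have "even (s (a, b))"
        using that by (cases r) (auto simp: w2_def t2_def, presburger)
      then have "even (int (s (a, b)))" by simp
      then have "even (a + b)" by (simp add: s_def)
      then obtain c where "a + b = 2 * c" by (elim evenE)
      then have "a = c + (a - c) \<and> b = c - (a - c)" by simp
      then show ?thesis by blast
    qed
    show "(\<lambda>((a, b), r). (((a + b) div 2, (a - b) div 2), r)) \<in> {x. w2 x = 2 * n} \<rightarrow> {x. w x = n}"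
    proof
      fix x assume that: "x \<in> {x. w2 x = 2 * n}"
      obtain a b r where "x = ((a, b), r)" by (metis surj_pair)
      with that have x: "x = ((a, b), r)" "w2 ((a, b), r) = 2 * n" by simp_all
      then obtain c d where "a = c + d" "b = c - d" using half by blast
      then show "(case x of (p, r) \<Rightarrow> (case p of (a, b) \<Rightarrow> \<lambda>r. (((a + b) div 2, (a - b) div 2), r)) r) \<in> {x. w x = n}"
        using x w2[of c d r] by simp
    qed
    show "(case (case x of (p, r) \<Rightarrow> (case p of (c, d) \<Rightarrow> \<lambda>r. ((c + d, c - d), r)) r) of
        (p, r) \<Rightarrow> (case p of (a, b) \<Rightarrow> \<lambda>r. (((a + b) div 2, (a - b) div 2), r)) r) = x" for x :: "(int \<times> int) \<times> int \<times> int"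
      by (auto split: prod.splits)
    show "(case (case x of (p, r) \<Rightarrow> (case p of (a, b) \<Rightarrow> \<lambda>r. (((a + b) div 2, (a - b) div 2), r)) r) of
        (p, r) \<Rightarrow> (case p of (c, d) \<Rightarrow> \<lambda>r. ((c + d, c - d), r)) r) = x" if "x \<in> {x. w2 x = 2 * n}" for x
    proof -
      obtain a b r where "x = ((a, b), r)" by (metis surj_pair)
      with that have x: "x = ((a, b), r)" "w2 ((a, b), r) = 2 * n" by simp_all
      then obtain c d where "a = c + d" "b = c - d" using half by blast
      then show ?thesis using x by simp
    qed
  qed
  then have "enumerator UNIV w2 $ (2 * n) = enumerator UNIV w $ n"
    by (simp add: enumerator_nth bij_betw_same_card)
  also have "enumerator UNIV w = theta_square\<^sup>2 * (2 * theta_tri)\<^sup>2"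
    using enumerator_mult[OF s(2) t(2)] by (simp add: w_def s t enumerator_triz[symmetric])
  also have "enumerator UNIV w2 = theta_square\<^sup>2 * (enumerator UNIV (\<lambda>k. 2 * triz k))\<^sup>2"
    using enumerator_mult[OF s(2) t2(2)] by (simp add: w2_def s t2)
  also have "\<dots> = (2 * theta_tri\<^sup>2)\<^sup>2"
    unfolding theta_tri_square by (simp add: power_mult_distrib)
  also have "\<dots> = 4 * theta_tri ^ 4"
    by (simp add: power_mult_distrib flip: power_mult)
  also have "theta_square\<^sup>2 * (2 * theta_tri)\<^sup>2 = 4 * (theta_square\<^sup>2 * theta_tri\<^sup>2)"
    by (simp add: power_mult_distrib)
  finally show ?thesis by (simp add: numeral_fps_const)
qed

section \<open>The divisor sum\<close>

text \<open>At 0 the set of divisors is infinite and the sum takes its default value 0; this settles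
  the case of a zero factor in the multiplicativity proof.\<close>

definition divisor_sigma :: "nat \<Rightarrow> nat" where
  "divisor_sigma n = \<Sum>{d. d dvd n}"

lemma divisor_sigma_mult:
  assumes "coprime a b"
  shows "divisor_sigma (a * b) = divisor_sigma a * divisor_sigma b"
proof (cases "a = 0 \<or> b = 0")
  case False
  \<comment> \<open>The divisor \<open>d * e\<close> of \<open>a * b\<close> determines its two
    parts as its gcds with \<open>a\<close> and \<open>b\<close>, which gives the inverse of the
    multiplication map.\<close>
  have gcd: "gcd (d * e) a = d" "gcd (d * e) b = e" if "d dvd a" "e dvd b" for d e
  proof -
    have "coprime e a" "coprime d b"
      using that assms by (meson coprime_commute coprime_divisors dvd_refl)+
    then show "gcd (d * e) a = d" "gcd (d * e) b = e"
      using that gcd_mult_left_right_cancel[of a e d] gcd_mult_left_left_cancel[of b d e]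
      by (simp_all add: coprime_commute gcd_nat.absorb1)
  qed
  have "divisor_sigma (a * b) = (\<Sum>(d, e)\<in>{d. d dvd a} \<times> {e. e dvd b}. d * e)"
    unfolding divisor_sigma_def
  proof (rule sum.reindex_bij_witness[of _ "\<lambda>(d, e). d * e" "\<lambda>x. (gcd x a, gcd x b)"])
    fix x assume "x \<in> {d. d dvd a * b}"
    then obtain d e where "x = d * e" "d dvd a" "e dvd b"
      using division_decomp[of x a b] by auto
    then show "(case (gcd x a, gcd x b) of (d, e) \<Rightarrow> d * e) = x"
      "(case (gcd x a, gcd x b) of (d, e) \<Rightarrow> d * e) = x" by (simp_all add: gcd)
  qed (auto simp: gcd mult_dvd_mono)
  then show ?thesis
    by (simp add: divisor_sigma_def sum_product sum.cartesian_product)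
qed (auto simp: divisor_sigma_def)

lemma divisor_sigma_prod:
  assumes "finite P" "\<And>p. p \<in> P \<Longrightarrow> prime p"
  shows "divisor_sigma (\<Prod>p\<in>P. p ^ f p) = (\<Prod>p\<in>P. divisor_sigma (p ^ f p))"
  using assms
proof (induction P rule: finite_induct)
  case empty
  show ?case by (simp add: divisor_sigma_def)
next
  case (insert p P)
  have "coprime (p ^ f p) (\<Prod>p\<in>P. p ^ f p)"
    using insert by (intro prod_coprime_right) (auto intro!: primes_coprime simp: coprime_power_left_iff coprime_power_right_iff)
  then show ?case using insert by (simp add: divisor_sigma_mult)
qed

lemma divisor_sigma_prime_power:
  assumes "prime p"
  shows "divisor_sigma (p ^ k) = (\<Sum>i\<le>k. p ^ i)"
proof -
  have "{d. d dvd p ^ k} = (\<lambda>i. p ^ i) ` {..k}"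
    by (auto simp: divides_primepow_nat[OF assms])
  moreover have "inj_on (\<lambda>i. p ^ i) {..k}"
    using prime_gt_1_nat[OF assms] by (simp add: inj_on_def)
  ultimately show ?thesis by (simp add: divisor_sigma_def sum.reindex)
qed

text \<open>An even exponent gives an odd number of odd summands.\<close>

lemma odd_divisor_sigma:
  assumes "prime p" "odd p" "even k"
  shows "odd (divisor_sigma (p ^ k))"
proof -
  have "odd (\<Sum>i\<le>2 * j. p ^ i)" for j
    using assms(2) by (induction j) auto
  moreover obtain j where "k = 2 * j" using assms(3) by (elim evenE)
  ultimately show ?thesis by (simp only: divisor_sigma_prime_power[OF assms(1)] not_False_eq_True)
qed

text \<open>The powers of \<open>p\<close> pair up as \<open>p ^ (2 * i) * (1 + p)\<close>, and odd
  squares are 1 modulo 8.\<close>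

lemma divisor_sigma_odd_exponent:
  assumes "prime p" "odd p"
  shows "[divisor_sigma (p ^ (2 * j + 1)) = (1 + p) * (j + 1)] (mod 8)"
proof -
  have "[p\<^sup>2 = 1] (mod 8)"
  proof -
    have "p mod 8 = 1 \<or> p mod 8 = 3 \<or> p mod 8 = 5 \<or> p mod 8 = 7" using assms(2) by presburger
    then have "(p mod 8)\<^sup>2 mod 8 = 1" by auto
    then show ?thesis by (simp add: cong_def power_mod)
  qed
  then have sq: "[p ^ (2 * i) = 1] (mod 8)" for i
    using cong_pow[of "p\<^sup>2" 1 8 i] by (simp add: power_mult)
  have eq: "(\<Sum>i\<le>2 * j + 1. p ^ i) = (1 + p) * (\<Sum>i\<le>j. p ^ (2 * i))"
    by (induction j) (simp_all add: algebra_simps)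
  have "[(\<Sum>i\<le>j. p ^ (2 * i)) = (\<Sum>i\<le>j. 1)] (mod 8)"
    by (intro cong_sum sq)
  then have "[(1 + p) * (\<Sum>i\<le>j. p ^ (2 * i)) = (1 + p) * (\<Sum>i\<le>j. 1)] (mod 8)"
    by (rule cong_scalar_left)
  moreover have "(\<Sum>i\<le>j. 1) = j + 1" by simp
  ultimately show ?thesis unfolding divisor_sigma_prime_power[OF assms(1)] eq by (simp only:)
qed

text \<open>With \<open>p = 2 * i + 1\<close> and \<open>k = 2 * j + 1\<close> the divisor sum is
  congruent to \<open>2 * (i + 1) * (j + 1)\<close> modulo 8, so everything depends on
  \<open>w = (i + 1) * (j + 1)\<close> modulo 4.\<close>

lemma divisor_sigma_odd_exponent_cases:
  assumes "prime p" "odd p" "odd k"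
  defines "s \<equiv> divisor_sigma (p ^ k)"
  shows "even s"
    and "p mod 4 = 1 \<Longrightarrow> k mod 4 = 1 \<Longrightarrow> s mod 4 = 2"
    and "p mod 4 = 1 \<Longrightarrow> k mod 8 = 3 \<Longrightarrow> s mod 8 = 4"
    and "p mod 4 = 1 \<Longrightarrow> k mod 8 = 7 \<Longrightarrow> 8 dvd s"
    and "p mod 4 = 3 \<or> k mod 4 = 3 \<Longrightarrow> 4 dvd s"
proof -
  obtain j where k: "k = 2 * j + 1" using assms(3) by (elim oddE)
  obtain i where p: "p = 2 * i + 1" using assms(2) by (elim oddE)
  have "s mod 8 = ((1 + p) * (j + 1)) mod 8"
    using divisor_sigma_odd_exponent[OF assms(1,2), of j] unfolding s_def k cong_def .
  moreover define w where "w = (i + 1) * (j + 1)"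
  have "(1 + p) * (j + 1) = 2 * w" unfolding w_def p by simp
  ultimately have s: "s mod 8 = (2 * w) mod 8" by (simp only:)
  then have s8: "s mod 8 = 2 * (w mod 4)" by (simp add: mult_mod_right)
  have s4: "s mod 4 = 2 * (w mod 2)"
  proof -
    have "s mod 4 = (s mod 8) mod 4" by (simp add: mod_mod_cancel)
    also have "\<dots> = (2 * w) mod 4" unfolding s by (simp add: mod_mod_cancel)
    finally show ?thesis by (simp add: mult_mod_right)
  qed
  have i: "odd i \<longleftrightarrow> p mod 4 = 3" "even i \<longleftrightarrow> p mod 4 = 1"
    unfolding p by presburger+
  have j: "odd j \<longleftrightarrow> k mod 4 = 3" "even j \<longleftrightarrow> k mod 4 = 1"
    unfolding k by presburger+
  show "even s"
  proof -
    have "s mod 2 = (s mod 4) mod 2" by (simp add: mod_mod_cancel)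
    then show ?thesis unfolding s4 by (simp add: even_iff_mod_2_eq_zero)
  qed
  show "s mod 4 = 2" if "p mod 4 = 1" "k mod 4 = 1"
  proof -
    have "odd w" using that i j by (simp add: w_def)
    then show ?thesis unfolding s4 by (simp add: odd_iff_mod_2_eq_one)
  qed
  show "s mod 8 = 4" if "p mod 4 = 1" "k mod 8 = 3"
  proof -
    \<comment> \<open>The condition \<open>k mod 8 = 3\<close> means \<open>j mod 4 = 1\<close>, so
      \<open>j + 1\<close> is twice an odd number.\<close>
    define l where "l = j div 4"
    have l: "j + 1 = 2 * (2 * l + 1)" using that(2) unfolding k l_def by presburger
    define u where "u = (i + 1) * (2 * l + 1)"
    have "odd u" using i that(1) by (simp add: u_def)
    then obtain v where "u = 2 * v + 1" by (elim oddE)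
    moreover have "w = 2 * u" unfolding w_def u_def l by simp
    ultimately have "w = 2 + 4 * v" by simp
    then have "w mod 4 = 2" by (simp only: mod_mult_self2) simp
    then show ?thesis unfolding s8 by simp
  qed
  show "8 dvd s" if "p mod 4 = 1" "k mod 8 = 7"
  proof -
    have "4 dvd j + 1" using that(2) unfolding k by presburger
    then have "4 dvd w" unfolding w_def by (rule dvd_mult)
    then have "s mod 8 = 0" unfolding s8 by simp
    then show ?thesis by (simp only: dvd_eq_mod_eq_0)
  qed
  show "4 dvd s" if "p mod 4 = 3 \<or> k mod 4 = 3"
  proof -
    have "even w" using that i j by (auto simp: w_def)
    then have "s mod 4 = 0" unfolding s4 by simp
    then show ?thesis by (simp only: dvd_eq_mod_eq_0)
  qed
qed

section \<open>Sums of four triangular numbers\<close>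

text \<open>In a solution \<open>x\<close> is odd. Writing \<open>x = 2 * k + 1\<close> gives
  \<open>y * z = 2 * (n - triz k) + 1\<close>, so for fixed \<open>k\<close> the entry
  \<open>y\<close> runs over the divisors of this number, and \<open>y * z - x\<^sup>2\<close>
  depends on \<open>k\<close> alone.\<close>

lemma zagier_divisor_sum:
  "(\<Sum>(y, x, z)\<in>zagier (8 * int n + 5). y * (y * z - x\<^sup>2)) =
    (\<Sum>k | triz k \<le> n. 2 * (int n - 5 * int (triz k)) * int (divisor_sigma (2 * (n - triz k) + 1)))"
proof -
  define m where "m k = 2 * (n - triz k) + 1" for k
  define K where "K = {k. triz k \<le> n}"
  have sq: "(2 * k + 1)\<^sup>2 = 8 * int (triz k) + 1" for k
    using two_triz[of k] by (simp add: power2_eq_square algebra_simps)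
  have m: "int (m k) = 2 * (int n - int (triz k)) + 1" if "k \<in> K" for k
    using that by (simp add: m_def K_def of_nat_diff)
  have fK: "finite K"
  proof -
    have "K = (\<Union>i\<in>{..n}. {k \<in> UNIV. triz k = i})" by (auto simp: K_def)
    then show ?thesis using finite_fibresD[OF finite_fibres_triz] by simp
  qed
  have fm: "finite {d. d dvd m k}" for k by (simp add: m_def)
  have zagierE: thesis
    if "t \<in> zagier (8 * int n + 5)"
      and "\<And>k d e. t = (int d, 2 * k + 1, int e) \<Longrightarrow> k \<in> K \<Longrightarrow> m k = d * e \<Longrightarrow> d > 0 \<Longrightarrow> thesis"
    for t thesis
  proof -
    from that(1) obtain y x z where t: "t = (y, x, z)" "y > 0" "z > 0" "x\<^sup>2 + 4 * y * z = 8 * int n + 5"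
      by (auto simp: zagier_def)
    then have "x\<^sup>2 = 2 * (4 * int n + 2 - 2 * (y * z)) + 1" by simp
    then have "odd (x\<^sup>2)" by (metis odd_two_times_div_two_succ even_mult_iff even_plus_one_iff dvd_triv_left)
    then obtain k where x: "x = 2 * k + 1" by (auto elim: oddE)
    have yz: "y * z = 2 * (int n - int (triz k)) + 1"
      using t(4) sq[of k] by (simp add: x)
    have "y * z > 0" using t by simp
    then have k: "k \<in> K" using yz by (simp add: K_def)
    have "int (m k) = int (nat y) * int (nat z)" using t yz m[OF k] by simp
    then have "m k = nat y * nat z" by (simp only: of_nat_mult[symmetric] of_nat_eq_iff)
    then show ?thesis using that(2)[of "nat y" k "nat z"] k t by (simp add: x)
  qed
  have "(\<Sum>(y, x, z)\<in>zagier (8 * int n + 5). y * (y * z - x\<^sup>2)) =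
      (\<Sum>(k, d)\<in>Sigma K (\<lambda>k. {d. d dvd m k}). int d * (int (m k) - (2 * k + 1)\<^sup>2))"
  proof (rule sum.reindex_bij_witness[of _ "\<lambda>(k, d). (int d, 2 * k + 1, int (m k div d))"
        "\<lambda>(y, x, z). ((x - 1) div 2, nat y)"], goal_cases)
    case (4 t)
    then obtain k d where "t = (k, d)" "k \<in> K" "d dvd m k" by auto
    then obtain e where t: "t = (k, d)" "k \<in> K" "m k = d * e" by (auto elim: dvdE)
    have "m k > 0" by (simp add: m_def)
    then have "d > 0" "e > 0" using t by auto
    moreover have "(2 * k + 1)\<^sup>2 + 4 * int d * int e = 8 * int n + 5"
      using m[OF t(2)] sq[of k] t(3) by simp
    ultimately show ?case using t by (simp add: zagier_def)
  qed (auto elim!: zagierE)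
  also have "\<dots> = (\<Sum>k\<in>K. \<Sum>d | d dvd m k. int d * (int (m k) - (2 * k + 1)\<^sup>2))"
    using fK fm by (intro sum.Sigma[symmetric]) auto
  also have "\<dots> = (\<Sum>k\<in>K. 2 * (int n - 5 * int (triz k)) * int (divisor_sigma (m k)))"
  proof (rule sum.cong)
    fix k assume "k \<in> K"
    then have "int (m k) - (2 * k + 1)\<^sup>2 = 2 * (int n - 5 * int (triz k))"
      using m[of k] sq[of k] by simp
    then show "(\<Sum>d | d dvd m k. int d * (int (m k) - (2 * k + 1)\<^sup>2)) =
        2 * (int n - 5 * int (triz k)) * int (divisor_sigma (m k))"
      by (simp add: divisor_sigma_def sum_distrib_right[symmetric] mult.commute)
  qed simp
  finally show ?thesis by (simp add: K_def m_def)
qed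

text \<open>Indices \<open>k\<close> are grouped by the value of \<open>triz\<close>. The weight
  \<open>n - 5 * t\<close> is \<open>(n - t) - 4 * t\<close>, so this is the coefficient form of an
  equation between the logarithmic derivatives of the divisor series and of \<psi>^4.\<close>

lemma theta_tri_divisor_sum:
  "(\<Sum>t=0..n. theta_tri $ t * ((int n - 5 * int t) * int (divisor_sigma (2 * (n - t) + 1)))) = 0"
proof -
  define h where "h t = (int n - 5 * int t) * int (divisor_sigma (2 * (n - t) + 1))" for t
  have fin: "finite {k. triz k \<le> n}"
  proof -
    have "{k. triz k \<le> n} = (\<Union>i\<in>{..n}. {k \<in> UNIV. triz k = i})" by auto
    then show ?thesis using finite_fibresD[OF finite_fibres_triz] by simp
  qed
  have "(8 * int n + 5) mod 8 = 5" by presburger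
  from zagier_sum[OF this] have "0 = (\<Sum>k | triz k \<le> n. 2 * h (triz k))"
    unfolding zagier_divisor_sum by (simp only: h_def mult.assoc)
  also have "\<dots> = (\<Sum>t=0..n. \<Sum>k | k \<in> {k. triz k \<le> n} \<and> triz k = t. 2 * h (triz k))"
    using fin by (intro sum.group[symmetric]) auto
  also have "\<dots> = (\<Sum>t=0..n. enumerator UNIV triz $ t * (2 * h t))"
  proof (rule sum.cong)
    fix t assume "t \<in> {0..n}"
    then have "{k \<in> {k. triz k \<le> n}. triz k = t} = {k \<in> UNIV. triz k = t}" by auto
    then show "(\<Sum>k | k \<in> {k. triz k \<le> n} \<and> triz k = t. 2 * h (triz k)) = enumerator UNIV triz $ t * (2 * h t)"
      by (simp add: enumerator_nth)
  qed simp
  also have "\<dots> = (\<Sum>t=0..n. 4 * (theta_tri $ t * h t))"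
  proof (rule sum.cong)
    fix t
    have "enumerator UNIV triz $ t = 2 * theta_tri $ t"
      unfolding enumerator_triz by (simp only: mult_2 fps_add_nth)
    then show "enumerator UNIV triz $ t * (2 * h t) = 4 * (theta_tri $ t * h t)" by simp
  qed simp
  finally show ?thesis by (simp add: h_def sum_distrib_left[symmetric])
qed

section \<open>Logarithmic derivatives and the formula for \<psi>^4\<close>

lemma fps_X_deriv_nth: "(fps_X * fps_deriv f) $ n = of_nat n * f $ n"
  by (cases n) simp_all

text \<open>Both series have logarithmic derivative \<open>4 * f' / f\<close>, stated without
  division. For their difference \<open>d\<close>, coefficient \<open>n\<close> of the equation
  expresses \<open>n * d $ n\<close> through earlier coefficients of \<open>d\<close>, which vanish
  by induction.\<close>

lemma fps_log_deriv_unique: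
  fixes f g h :: "int fps"
  assumes "fps_deriv g * f = 4 * fps_deriv f * g" "fps_deriv h * f = 4 * fps_deriv f * h"
    and "f $ 0 = 1" "g $ 0 = h $ 0"
  shows "g = h"
proof -
  define d where "d = g - h"
  have d: "(fps_X * fps_deriv d) * f = 4 * ((fps_X * fps_deriv f) * d)"
    using assms(1,2) by (simp add: d_def algebra_simps)
  have "d $ n = 0" for n
  proof (induction n rule: less_induct)
    case (less n)
    show ?case
    proof (cases "n = 0")
      case False
      have "((fps_X * fps_deriv d) * f) $ n = (\<Sum>i\<in>{0..n}. int i * d $ i * f $ (n - i))"
        unfolding fps_mult_nth[of "fps_X * fps_deriv d"] fps_X_deriv_nth by simp
      also have "\<dots> = (\<Sum>i\<in>{n}. int i * d $ i * f $ (n - i))"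
        using less by (intro sum.mono_neutral_right) auto
      finally have 1: "((fps_X * fps_deriv d) * f) $ n = int n * d $ n" using assms(3) by simp
      have "((fps_X * fps_deriv f) * d) $ n = (\<Sum>i\<in>{0..n}. int i * f $ i * d $ (n - i))"
        unfolding fps_mult_nth[of "fps_X * fps_deriv f"] fps_X_deriv_nth by simp
      also have "\<dots> = 0"
      proof (rule sum.neutral, rule ballI)
        fix i assume "i \<in> {0..n}"
        then show "int i * f $ i * d $ (n - i) = 0"
          using less[of "n - i"] False by (cases "i = 0") auto
      qed
      finally have "(4 * ((fps_X * fps_deriv f) * d)) $ n = 0" by (simp add: numeral_fps_const)
      then show ?thesis using 1 d False by simp
    qed (use assms(4) in \<open>simp add: d_def\<close>)
  qed
  then show ?thesis by (simp add: d_def fps_eq_iff)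
qed

text \<open>The classical count of representations as a sum of four triangular numbers.\<close>

lemma theta_tri_pow4: "theta_tri ^ 4 = Abs_fps (\<lambda>n. int (divisor_sigma (2 * n + 1)))"
proof (rule fps_log_deriv_unique)
  define F where "F = Abs_fps (\<lambda>n. int (divisor_sigma (2 * n + 1)))"
  show "fps_deriv (theta_tri ^ 4) * theta_tri = 4 * fps_deriv theta_tri * theta_tri ^ 4"
    by (simp add: power4_eq_xxxx algebra_simps)
  have "{k. tri k = 0} = {0}" using tri_inj[of _ 0] by auto
  then show 1: "theta_tri $ 0 = 1" by (simp add: theta_tri_def enumerator_nth)
  then show "(theta_tri ^ 4) $ 0 = Abs_fps (\<lambda>n. int (divisor_sigma (2 * n + 1))) $ 0"
    by (simp add: divisor_sigma_def fps_power_zeroth)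
  have "theta_tri * (fps_X * fps_deriv F) = 4 * ((fps_X * fps_deriv theta_tri) * F)"
  proof (rule fps_ext)
    fix n
    have "(theta_tri * (fps_X * fps_deriv F)) $ n =
        (\<Sum>t=0..n. theta_tri $ t * (int (n - t) * int (divisor_sigma (2 * (n - t) + 1))))"
      unfolding fps_mult_nth[of theta_tri] fps_X_deriv_nth by (simp add: F_def)
    \<comment> \<open>The splitting \<open>n - t = (n - 5 * t) + 4 * t\<close> isolates the sum
      known to vanish.\<close>
    also have "\<dots> = (\<Sum>t=0..n. theta_tri $ t * ((int n - 5 * int t) * int (divisor_sigma (2 * (n - t) + 1)))
        + 4 * (int t * theta_tri $ t * int (divisor_sigma (2 * (n - t) + 1))))"
      by (intro sum.cong) (auto simp: of_nat_diff algebra_simps)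
    also have "\<dots> = 4 * (\<Sum>t=0..n. int t * theta_tri $ t * int (divisor_sigma (2 * (n - t) + 1)))"
      by (simp only: sum.distrib theta_tri_divisor_sum sum_distrib_left add_0)
    also have "(\<Sum>t=0..n. int t * theta_tri $ t * int (divisor_sigma (2 * (n - t) + 1))) =
        ((fps_X * fps_deriv theta_tri) * F) $ n"
      unfolding fps_mult_nth[of "fps_X * fps_deriv theta_tri"] fps_X_deriv_nth by (simp add: F_def)
    finally show "(theta_tri * (fps_X * fps_deriv F)) $ n = (4 * ((fps_X * fps_deriv theta_tri) * F)) $ n"
      by (simp add: numeral_fps_const)
  qed
  then have "fps_X * (fps_deriv F * theta_tri) = fps_X * (4 * fps_deriv theta_tri * F)"
    by (simp add: ac_simps)
  then show "fps_deriv (Abs_fps (\<lambda>n. int (divisor_sigma (2 * n + 1)))) * theta_tri =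
      4 * fps_deriv theta_tri * Abs_fps (\<lambda>n. int (divisor_sigma (2 * n + 1)))"
    unfolding F_def by (simp only: mult_cancel_left) simp
qed

lemma ped2_cong_sigma: "[(-1) ^ n * int (ped2 n) = int (divisor_sigma (4 * n + 1))] (mod 8)"
  using ped2_cong[of n] theta_dissection[of n] by (simp add: theta_tri_pow4)

section \<open>Classification modulo 8\<close>

lemma even_card_power_dvd_prod:
  fixes f :: "'a \<Rightarrow> nat"
  assumes "finite A" "\<And>x. x \<in> A \<Longrightarrow> even (f x)"
  shows "2 ^ card A dvd prod f A"
proof -
  have "(\<Prod>x\<in>A. 2) dvd prod f A" using assms by (intro prod_dvd_prod) auto
  then show ?thesis by simp
qed

lemma odd_mult_mod_4:
  fixes u s :: nat
  assumes "odd u" "s mod 4 = 2"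
  shows "(u * s) mod 4 = 2"
proof -
  obtain v where v: "u = 2 * v + 1" using assms(1) by (elim oddE)
  have "(u * s) mod 4 = (u * 2) mod 4" by (simp only: mod_mult_right_eq[of u s, symmetric] assms(2))
  also have "u * 2 = 2 + 4 * v" unfolding v by simp
  finally show ?thesis by (simp only: mod_mult_self2) simp
qed

lemma odd_mult_mod_8:
  fixes u s :: nat
  assumes "odd u" "s mod 8 = 4"
  shows "(u * s) mod 8 = 4"
proof -
  obtain v where v: "u = 2 * v + 1" using assms(1) by (elim oddE)
  have "(u * s) mod 8 = (u * 4) mod 8" by (simp only: mod_mult_right_eq[of u s, symmetric] assms(2))
  also have "u * 4 = 4 + 8 * v" unfolding v by simp
  finally show ?thesis by (simp only: mod_mult_self2) simp
qed

section \<open>Divisor sum of \<open>m\<close> in terms of its square-free part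
  \<open>M\<close>\<close>

context
  fixes m N M :: nat
  assumes m: "m = N\<^sup>2 * M" "m mod 4 = 1" and pos: "N > 0" "M > 0" and sqf: "squarefree M"
begin

lemma odd_prime_factor: "prime p \<Longrightarrow> p dvd m \<Longrightarrow> odd p"
proof
  assume "p dvd m" "even p"
  then have "even m" by (rule dvd_trans[rotated])
  then show False using m(2) by presburger
qed

text \<open>\<open>N\<close> is odd, so its square is 1 modulo 4. When \<open>M\<close> is prime
  this supplies the residue condition on that prime.\<close>

lemma squarefree_part_mod_4: "M mod 4 = 1"
proof -
  have "odd m" using m(2) by presburger
  then have "odd N" using m(1) by auto
  then have "N mod 4 = 1 \<or> N mod 4 = 3" by presburger
  then have "N\<^sup>2 mod 4 = 1" by (auto simp: power_mod[symmetric, of N])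
  then have "m mod 4 = M mod 4" unfolding m(1) by (metis mod_mult_left_eq mult_1)
  then show ?thesis using m(2) by simp
qed

lemma odd_multiplicity_iff:
  assumes "prime p"
  shows "odd (multiplicity p m) \<longleftrightarrow> p dvd M"
proof -
  have "multiplicity p m = 2 * multiplicity p N + multiplicity p M"
    using assms pos unfolding m(1)
    by (simp add: prime_elem_multiplicity_mult_distrib prime_elem_multiplicity_power_distrib)
  moreover have "multiplicity p M \<le> 1"
    using sqf pos assms by (auto simp: squarefree_factorial_semiring'' prime_elem_nat_iff)
  moreover have "p dvd M \<longleftrightarrow> multiplicity p M > 0"
    using assms pos by (simp add: prime_multiplicity_gt_zero_iff)
  ultimately show ?thesis by (cases "multiplicity p M = 0") auto
qed

lemma squarefree_part_eq_prod: "M = \<Prod>(prime_factors M)"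
proof -
  have "multiplicity p M = 1" if "p \<in> prime_factors M" for p
  proof -
    have "multiplicity p M \<le> 1"
      using sqf pos that by (auto simp: squarefree_factorial_semiring'' prime_elem_nat_iff in_prime_factors_iff)
    moreover have "multiplicity p M > 0" using that by (simp add: prime_factors_multiplicity)
    ultimately show ?thesis by simp
  qed
  then show ?thesis using prime_factorization_nat[OF pos(2)] by simp
qed

text \<open>Primes outside \<open>M\<close> have even exponent in \<open>m\<close> and contribute
  odd factors, collected in \<open>u\<close>; the 2-adic behaviour is decided by the primes of
  \<open>M\<close>.\<close>

lemma divisor_sigma_squarefree_part:
  obtains u where "odd u"
    "divisor_sigma m = u * (\<Prod>p\<in>prime_factors M. divisor_sigma (p ^ multiplicity p m))"
proof
  let ?s = "\<lambda>p. divisor_sigma (p ^ multiplicity p m)"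
  let ?R = "prime_factors m - prime_factors M"
  have m0: "m > 0" using m pos by simp
  have sub: "prime_factors M \<subseteq> prime_factors m"
    using m0 m(1) by (intro dvd_prime_factors) auto
  show "odd (\<Prod>p\<in>?R. ?s p)"
  proof -
    have "odd (?s p)" if "p \<in> ?R" for p
      using that pos odd_multiplicity_iff[of p] odd_prime_factor[of p]
      by (intro odd_divisor_sigma) (auto simp: in_prime_factors_iff)
    then show ?thesis by (simp add: even_prod_iff)
  qed
  have "divisor_sigma m = (\<Prod>p\<in>prime_factors m. ?s p)"
    by (subst prime_factorization_nat[OF m0], rule divisor_sigma_prod) auto
  also have "\<dots> = (\<Prod>p\<in>?R. ?s p) * (\<Prod>p\<in>prime_factors M. ?s p)"
    using sub by (intro prod.subset_diff) auto
  finally show "divisor_sigma m = (\<Prod>p\<in>?R. ?s p) * (\<Prod>p\<in>prime_factors M. ?s p)" .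
qed

lemma squarefree_part_prime_factor:
  assumes "p \<in> prime_factors M"
  shows "prime p" "odd p" "odd (multiplicity p m)"
  using assms odd_prime_factor[of p] odd_multiplicity_iff[of p] m(1)
  by (auto simp: in_prime_factors_iff)

lemma divisor_sigma_square: "M = 1 \<Longrightarrow> odd (divisor_sigma m)"
  using divisor_sigma_squarefree_part by fastforce

lemma divisor_sigma_square_times_prime:
  assumes "prime M"
  obtains u where "odd u" "divisor_sigma m = u * divisor_sigma (M ^ multiplicity M m)"
proof -
  obtain u where u: "odd u"
    "divisor_sigma m = u * (\<Prod>p\<in>prime_factors M. divisor_sigma (p ^ multiplicity p m))"
    by (rule divisor_sigma_squarefree_part)
  show ?thesis
    by (rule that[OF u(1)]) (simp add: u(2) prime_prime_factors[OF assms])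
qed

lemma divisor_sigma_square_times_two_primes:
  assumes "prime p" "prime q" "p \<noteq> q" "M = p * q"
  obtains u where "odd u" "divisor_sigma m =
    u * (divisor_sigma (p ^ multiplicity p m) * divisor_sigma (q ^ multiplicity q m))"
proof -
  have P: "prime_factors M = {p, q}"
    using assms by (auto simp: prime_factors_product prime_prime_factors)
  obtain u where u: "odd u"
    "divisor_sigma m = u * (\<Prod>p\<in>prime_factors M. divisor_sigma (p ^ multiplicity p m))"
    by (rule divisor_sigma_squarefree_part)
  show ?thesis
  proof (rule that[OF u(1)])
    show "divisor_sigma m = u * (divisor_sigma (p ^ multiplicity p m) * divisor_sigma (q ^ multiplicity q m))"
      using u(2) assms(3) unfolding P by simp
  qed
qed

lemma divisor_sigma_prime_mod_4:
  assumes "prime M" "multiplicity M m mod 4 = 1"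
  shows "divisor_sigma m mod 4 = 2"
proof -
  have M: "M \<in> prime_factors M" using assms by (simp add: prime_prime_factors)
  obtain u where u: "odd u" "divisor_sigma m = u * divisor_sigma (M ^ multiplicity M m)"
    by (rule divisor_sigma_square_times_prime[OF assms(1)])
  show ?thesis
    unfolding u(2)
    by (rule odd_mult_mod_4[OF u(1) divisor_sigma_odd_exponent_cases(2)[OF squarefree_part_prime_factor[OF M] squarefree_part_mod_4 assms(2)]])
qed

lemma divisor_sigma_prime_mod_8:
  assumes "prime M" "multiplicity M m mod 8 = 3"
  shows "divisor_sigma m mod 8 = 4"
proof -
  have M: "M \<in> prime_factors M" using assms by (simp add: prime_prime_factors)
  obtain u where u: "odd u" "divisor_sigma m = u * divisor_sigma (M ^ multiplicity M m)"
    by (rule divisor_sigma_square_times_prime[OF assms(1)])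
  show ?thesis
    unfolding u(2)
    by (rule odd_mult_mod_8[OF u(1) divisor_sigma_odd_exponent_cases(3)[OF squarefree_part_prime_factor[OF M] squarefree_part_mod_4 assms(2)]])
qed

lemma divisor_sigma_two_primes_mod_8:
  assumes "prime p" "prime q" "p \<noteq> q" "M = p * q"
    and "p mod 4 = 1" "q mod 4 = 1" "multiplicity p m mod 4 = 1" "multiplicity q m mod 4 = 1"
  shows "divisor_sigma m mod 8 = 4"
proof -
  obtain u where u: "odd u" "divisor_sigma m =
      u * (divisor_sigma (p ^ multiplicity p m) * divisor_sigma (q ^ multiplicity q m))"
    using divisor_sigma_square_times_two_primes[OF assms(1-4)] .
  have pq: "p \<in> prime_factors M" "q \<in> prime_factors M"
    using assms by (auto simp: prime_factors_product prime_prime_factors)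
  have 1: "divisor_sigma (p ^ multiplicity p m) mod 4 = 2" "divisor_sigma (q ^ multiplicity q m) mod 4 = 2"
    by (rule divisor_sigma_odd_exponent_cases(2)[OF squarefree_part_prime_factor[OF pq(1)] assms(5,7)]
        divisor_sigma_odd_exponent_cases(2)[OF squarefree_part_prime_factor[OF pq(2)] assms(6,8)])+
  have mul: "(a * b) mod 8 = 4" if "a mod 4 = 2" "b mod 4 = 2" for a b :: nat
  proof -
    define v w where "v = a div 4" and "w = b div 4"
    have "a = 2 + 4 * v" "b = 2 + 4 * w"
      using that mod_mult_div_eq[of a 4] mod_mult_div_eq[of b 4] by (simp_all add: v_def w_def)
    then have "a * b = 4 + 8 * (2 * v * w + v + w)" by (simp add: algebra_simps)
    then show ?thesis by (simp only: mod_mult_self2) simp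
  qed
  show ?thesis unfolding u(2) by (intro odd_mult_mod_8[OF u(1)] mul 1)
qed

text \<open>Each prime of \<open>M\<close> contributes an even factor, so three primes suffice. With
  two primes the excluded case forces one factor to be divisible by 4; with one prime the exponent
  must be 7 modulo 8.\<close>

lemma divisor_sigma_otherwise_mod_8:
  assumes "M \<noteq> 1"
    and "\<not> (prime M \<and> multiplicity M m mod 4 = 1)"
    and "\<not> (prime M \<and> multiplicity M m mod 8 = 3)"
    and "\<not> (\<exists>p q. prime p \<and> prime q \<and> p \<noteq> q \<and> M = p * q \<and>
        p mod 4 = 1 \<and> q mod 4 = 1 \<and> multiplicity p m mod 4 = 1 \<and> multiplicity q m mod 4 = 1)"
  shows "8 dvd divisor_sigma m"
proof -
  let ?s = "\<lambda>p. divisor_sigma (p ^ multiplicity p m)"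
  let ?P = "prime_factors M"
  have "?P \<noteq> {}"
  proof
    assume *: "?P = {}"
    show False using squarefree_part_eq_prod[unfolded *] assms(1) by simp
  qed
  then have "card ?P \<noteq> 0" by simp
  then consider "card ?P = 1" | "card ?P = 2" | "card ?P \<ge> 3" by linarith
  then show ?thesis
  proof cases
    case 1
    then obtain p where p: "?P = {p}" by (elim card_1_singletonE)
    have M1: "M = p" using squarefree_part_eq_prod[unfolded p] by simp
    then have M: "M = p" "M \<in> ?P" unfolding p by (assumption, simp)
    then have "prime M" by (simp add: in_prime_factors_iff)
    have "k mod 8 = 7" if "odd k" "k mod 4 \<noteq> 1" "k mod 8 \<noteq> 3" for k :: nat
      using that by presburger
    then have "multiplicity M m mod 8 = 7"
      using squarefree_part_prime_factor(3)[OF M(2)] assms(2,3) \<open>prime M\<close> by blast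
    then have "8 dvd ?s M"
      by (rule divisor_sigma_odd_exponent_cases(4)[OF squarefree_part_prime_factor[OF M(2)] squarefree_part_mod_4])
    moreover obtain u where "divisor_sigma m = u * ?s M"
      by (rule divisor_sigma_square_times_prime[OF \<open>prime M\<close>])
    ultimately show ?thesis by simp
  next
    case 2
    then obtain p q where pq: "?P = {p, q}" "p \<noteq> q"
      unfolding card_2_iff by blast
    have M: "M = p * q" using squarefree_part_eq_prod[unfolded pq(1)] pq(2) by simp
    have "p \<in> ?P" "q \<in> ?P" unfolding pq(1) by simp_all
    note p = squarefree_part_prime_factor[OF this(1)] and q = squarefree_part_prime_factor[OF this(2)]
    obtain u where u: "divisor_sigma m = u * (?s p * ?s q)"
      by (rule divisor_sigma_square_times_two_primes[OF p(1) q(1) pq(2) M])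
    have "2 dvd ?s p" "2 dvd ?s q"
      using divisor_sigma_odd_exponent_cases(1)[OF p] divisor_sigma_odd_exponent_cases(1)[OF q] by (simp_all only:)
    moreover have "4 dvd ?s p \<or> 4 dvd ?s q"
    proof -
      have "\<not> (p mod 4 = 1 \<and> q mod 4 = 1 \<and> multiplicity p m mod 4 = 1 \<and> multiplicity q m mod 4 = 1)"
      proof
        assume "p mod 4 = 1 \<and> q mod 4 = 1 \<and> multiplicity p m mod 4 = 1 \<and> multiplicity q m mod 4 = 1"
        then have "prime p \<and> prime q \<and> p \<noteq> q \<and> M = p * q \<and>
            p mod 4 = 1 \<and> q mod 4 = 1 \<and> multiplicity p m mod 4 = 1 \<and> multiplicity q m mod 4 = 1"
          by (intro conjI p(1) q(1) pq(2) M) simp_all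
        then have "\<exists>p q. prime p \<and> prime q \<and> p \<noteq> q \<and> M = p * q \<and>
            p mod 4 = 1 \<and> q mod 4 = 1 \<and> multiplicity p m mod 4 = 1 \<and> multiplicity q m mod 4 = 1"
          by (intro exI)
        with assms(4) show False by (rule notE)
      qed
      moreover have *: "k mod 4 = 1 \<or> k mod 4 = 3" if "odd k" for k :: nat
        using that by presburger
      ultimately have "(p mod 4 = 3 \<or> multiplicity p m mod 4 = 3) \<or> (q mod 4 = 3 \<or> multiplicity q m mod 4 = 3)"
        using *[OF p(2)] *[OF q(2)] *[OF p(3)] *[OF q(3)] by argo
      then show ?thesis
        using divisor_sigma_odd_exponent_cases(5)[OF p] divisor_sigma_odd_exponent_cases(5)[OF q] by argo
    qed
    ultimately have "4 * 2 dvd ?s p * ?s q \<or> 2 * 4 dvd ?s p * ?s q"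
      by (meson mult_dvd_mono)
    then show ?thesis unfolding u by (simp add: dvd_mult)
  next
    case 3
    have "(2 :: nat) ^ 3 dvd 2 ^ card ?P" by (rule le_imp_power_dvd[OF 3])
    also have "\<dots> dvd (\<Prod>p\<in>?P. ?s p)"
      by (intro even_card_power_dvd_prod finite_set_mset
          divisor_sigma_odd_exponent_cases(1)[OF squarefree_part_prime_factor])
    finally have "8 dvd (\<Prod>p\<in>?P. ?s p)" by simp
    moreover obtain u where "divisor_sigma m = u * (\<Prod>p\<in>?P. ?s p)"
      by (rule divisor_sigma_squarefree_part)
    ultimately show ?thesis by simp
  qed
qed

end

section \<open>Transfer from the divisor sum to \<open>ped2\<close>\<close>

lemma residue_up_to_sign:
  fixes a s :: nat
  assumes "a mod 8 = s mod 8 \<or> (a + s) mod 8 = 0"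
  shows "odd s \<Longrightarrow> odd a" "s mod 4 = 2 \<Longrightarrow> a mod 4 = 2" "s mod 8 = 4 \<Longrightarrow> a mod 8 = 4" "8 dvd s \<Longrightarrow> a mod 8 = 0"
proof -
  define r t where "r = a mod 8" and "t = s mod 8"
  have lt: "r < 8" "t < 8" by (simp_all add: r_def t_def)
  have "x = 0 \<or> x = 8" if "x mod 8 = 0" "x < 16" for x :: nat
    using that by presburger
  moreover have "r = t \<or> (r + t) mod 8 = 0"
    using assms by (simp only: r_def t_def mod_add_eq)
  ultimately have "r = t \<or> r + t = 0 \<or> r + t = 8"
    using lt add_strict_mono[OF lt] by fastforce
  moreover have "t = 0 \<or> t = 1 \<or> t = 2 \<or> t = 3 \<or> t = 4 \<or> t = 5 \<or> t = 6 \<or> t = 7"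
    using lt by linarith
  ultimately have "(t = 0 \<and> (r = 0 \<or> r = 8)) \<or> (t = 1 \<and> (r = 1 \<or> r = 7)) \<or> (t = 2 \<and> (r = 2 \<or> r = 6)) \<or>
      (t = 3 \<and> (r = 3 \<or> r = 5)) \<or> (t = 4 \<and> r = 4) \<or> (t = 5 \<and> (r = 5 \<or> r = 3)) \<or>
      (t = 6 \<and> (r = 6 \<or> r = 2)) \<or> (t = 7 \<and> (r = 7 \<or> r = 1))"
    \<comment> \<open>The sign is harmless: the odd residues and the classes 2 modulo 4, 4 modulo 8
      and 0 modulo 8 are each closed under negation.\<close>
    by (elim disjE) simp_all
  moreover have "odd a \<longleftrightarrow> odd r" "odd s \<longleftrightarrow> odd t" "8 dvd s \<longleftrightarrow> t = 0"
    unfolding r_def t_def by presburger+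
  moreover have "a mod 4 = r mod 4" "s mod 4 = t mod 4"
    unfolding r_def t_def by (simp_all add: mod_mod_cancel)
  ultimately show "odd s \<Longrightarrow> odd a" "s mod 4 = 2 \<Longrightarrow> a mod 4 = 2"
      "s mod 8 = 4 \<Longrightarrow> a mod 8 = 4" "8 dvd s \<Longrightarrow> a mod 8 = 0"
    using lt unfolding r_def[symmetric] t_def[symmetric] by auto
qed

theorem theorem1p6:
  fixes n N M :: nat
  assumes "N > 0" and "M > 0"
    and "4 * n + 1 = N\<^sup>2 * M"
    and "squarefree M"
  shows
    "(M = 1 \<longrightarrow> odd (ped2 n)) \<and>
     (prime M \<and> [multiplicity M (4 * n + 1) = 1] (mod 4) \<longrightarrow> [ped2 n = 2] (mod 4)) \<and>
     (prime M \<and> [multiplicity M (4 * n + 1) = 3] (mod 8) \<longrightarrow> [ped2 n = 4] (mod 8)) \<and>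
     ((\<exists>p1 p2. prime p1 \<and> prime p2 \<and> p1 \<noteq> p2 \<and> M = p1 * p2 \<and>
         (\<forall>p\<in>{p1, p2}. [p = 1] (mod 4) \<and> [multiplicity p (4 * n + 1) = 1] (mod 4)))
       \<longrightarrow> [ped2 n = 4] (mod 8)) \<and>
     (M \<noteq> 1 \<and>
      \<not> (prime M \<and> [multiplicity M (4 * n + 1) = 1] (mod 4)) \<and>
      \<not> (prime M \<and> [multiplicity M (4 * n + 1) = 3] (mod 8)) \<and>
      \<not> (\<exists>p1 p2. prime p1 \<and> prime p2 \<and> p1 \<noteq> p2 \<and> M = p1 * p2 \<and>
           (\<forall>p\<in>{p1, p2}. [p = 1] (mod 4) \<and> [multiplicity p (4 * n + 1) = 1] (mod 4)))
       \<longrightarrow> [ped2 n = 0] (mod 8))"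
proof -
  define s where "s = divisor_sigma (4 * n + 1)"
  \<comment> \<open>The sign \<open>(-1) ^ n\<close> becomes two alternatives over the natural
    numbers: equal residues for even \<open>n\<close>, opposite residues for odd
    \<open>n\<close>.\<close>
  have s: "ped2 n mod 8 = s mod 8 \<or> (ped2 n + s) mod 8 = 0"
  proof (cases "even n")
    case True
    then have "[int (ped2 n) = int s] (mod int 8)"
      using ped2_cong_sigma[of n] by (simp add: s_def)
    then have "[ped2 n = s] (mod 8)" by (simp only: cong_int_iff)
    then show ?thesis by (simp add: cong_def)
  next
    case False
    then have "[- int (ped2 n) = int s] (mod 8)"
      using ped2_cong_sigma[of n] by (simp add: s_def)
    then have "8 dvd - (- int (ped2 n) - int s)"
      by (simp only: cong_iff_dvd_diff dvd_minus_iff)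
    then have "int 8 dvd int (ped2 n + s)" by (simp add: add.commute)
    then have "8 dvd ped2 n + s" by (simp only: int_dvd_int_iff)
    then show ?thesis by (simp only: dvd_eq_mod_eq_0 simp_thms)
  qed
  have m: "4 * n + 1 = N\<^sup>2 * M" "(4 * n + 1) mod 4 = 1"
    using assms(3) by (assumption, presburger)
  note ctx = m assms(1,2,4)
  have 1: "M = 1 \<longrightarrow> odd (ped2 n)"
    using residue_up_to_sign(1)[OF s divisor_sigma_square[OF ctx, folded s_def]] by blast
  have 2: "ped2 n mod 4 = 2" if "prime M" "multiplicity M (4 * n + 1) mod 4 = 1"
    by (rule residue_up_to_sign(2)[OF s divisor_sigma_prime_mod_4[OF ctx that, folded s_def]])
  have 3: "ped2 n mod 8 = 4" if "prime M" "multiplicity M (4 * n + 1) mod 8 = 3"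
    by (rule residue_up_to_sign(3)[OF s divisor_sigma_prime_mod_8[OF ctx that, folded s_def]])
  have 4: "ped2 n mod 8 = 4" if "prime p" "prime q" "p \<noteq> q" "M = p * q" "p mod 4 = 1" "q mod 4 = 1"
    "multiplicity p (4 * n + 1) mod 4 = 1" "multiplicity q (4 * n + 1) mod 4 = 1" for p q
    by (rule residue_up_to_sign(3)[OF s divisor_sigma_two_primes_mod_8[OF ctx that, folded s_def]])
  have 5: "ped2 n mod 8 = 0" if "8 dvd s"
    by (rule residue_up_to_sign(4)[OF s that])
  have c: "[a = 1] (mod 4) \<longleftrightarrow> a mod 4 = 1" "[a = 2] (mod 4) \<longleftrightarrow> a mod 4 = 2"
    "[a = 3] (mod 8) \<longleftrightarrow> a mod 8 = 3" "[a = 4] (mod 8) \<longleftrightarrow> a mod 8 = 4" "[a = 0] (mod 8) \<longleftrightarrow> a mod 8 = 0"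
    for a :: nat
    by (simp_all add: cong_def)
  have 6: "ped2 n mod 8 = 0" if "M \<noteq> 1"
      "\<not> (prime M \<and> multiplicity M (4 * n + 1) mod 4 = 1)"
      "\<not> (prime M \<and> multiplicity M (4 * n + 1) mod 8 = 3)"
      "\<not> (\<exists>p1 p2. prime p1 \<and> prime p2 \<and> p1 \<noteq> p2 \<and> M = p1 * p2 \<and>
           (\<forall>p\<in>{p1, p2}. p mod 4 = 1 \<and> multiplicity p (4 * n + 1) mod 4 = 1))"
  proof (rule 5, unfold s_def, rule divisor_sigma_otherwise_mod_8[OF ctx that(1-3)], rule notI)
    assume "\<exists>p q. prime p \<and> prime q \<and> p \<noteq> q \<and> M = p * q \<and> p mod 4 = 1 \<and> q mod 4 = 1 \<and>
        multiplicity p (4 * n + 1) mod 4 = 1 \<and> multiplicity q (4 * n + 1) mod 4 = 1"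
    then obtain p q where "prime p \<and> prime q \<and> p \<noteq> q \<and> M = p * q \<and>
        (\<forall>r\<in>{p, q}. r mod 4 = 1 \<and> multiplicity r (4 * n + 1) mod 4 = 1)"
      by (elim exE conjE) simp
    then have "\<exists>p1 p2. prime p1 \<and> prime p2 \<and> p1 \<noteq> p2 \<and> M = p1 * p2 \<and>
        (\<forall>p\<in>{p1, p2}. p mod 4 = 1 \<and> multiplicity p (4 * n + 1) mod 4 = 1)"
      by (intro exI)
    with that(4) show False by (rule notE)
  qed
  show ?thesis
    unfolding c
  proof (intro conjI impI)
    show "odd (ped2 n)" if "M = 1" using 1 that by simp
    show "ped2 n mod 4 = 2" if "prime M \<and> multiplicity M (4 * n + 1) mod 4 = 1"
      using that by (elim conjE) (rule 2)
    show "ped2 n mod 8 = 4" if "prime M \<and> multiplicity M (4 * n + 1) mod 8 = 3"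
      using that by (elim conjE) (rule 3)
    show "ped2 n mod 8 = 4" if ex: "\<exists>p1 p2. prime p1 \<and> prime p2 \<and> p1 \<noteq> p2 \<and> M = p1 * p2 \<and>
        (\<forall>p\<in>{p1, p2}. p mod 4 = 1 \<and> multiplicity p (4 * n + 1) mod 4 = 1)"
    proof -
      obtain p1 p2 where p: "prime p1" "prime p2" "p1 \<noteq> p2" "M = p1 * p2"
        and q: "\<forall>p\<in>{p1, p2}. p mod 4 = 1 \<and> multiplicity p (4 * n + 1) mod 4 = 1"
        using ex by (elim exE conjE)
      show ?thesis by (rule 4[OF p]) (use q in blast)+
    qed
    show "ped2 n mod 8 = 0" if "M \<noteq> 1 \<and>
      \<not> (prime M \<and> multiplicity M (4 * n + 1) mod 4 = 1) \<and>
      \<not> (prime M \<and> multiplicity M (4 * n + 1) mod 8 = 3) \<and>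
      \<not> (\<exists>p1 p2. prime p1 \<and> prime p2 \<and> p1 \<noteq> p2 \<and> M = p1 * p2 \<and>
           (\<forall>p\<in>{p1, p2}. p mod 4 = 1 \<and> multiplicity p (4 * n + 1) mod 4 = 1))"
      using that by (elim conjE) (rule 6)
  qed
qed

end
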